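(* For any action hint $h\in\mathcal A\subseteq\mathbb{R}^{d+1}$ with $\|h\|=1$, any horizon $T$ and any learning algorithm, there is a family $\Theta$ of stochastic linear bandit instances (identified with their parameter vectors) so that the following holds. All parameters $\theta\in\Theta$ have $\Theta(1)$ norm. Let $$R_h=\max_{\theta\in\Theta}\mathbb{E}\big[\mathrm{Reg}^{\theta}_h(T)\big]$$ be the largest expected hint-based regret of the algorithm in the family $\Theta$. Then there is a bandit instance $\theta\in\Theta$ such that the expected regret with respect to the best arm satisfies $$\mathbb{E}\big[\mathrm{Reg}^{\theta}(T)\big]\;\ge\;\frac14+\frac{T}{4}\min\Big(1,\frac{d-1}{R_h}\Big)\;\ge\;\Omega\Big(\frac{dT}{R_h}\Big).$$
   Context: Stochastic linear bandit on the unit ball: the action set is $\mathcal{A}=\{a\in\mathbb{R}^{d+1}:\|a\|\le 1\}$ with the Euclidean norm. An instance is given by a parameter $\theta\in\mathbb{R}^{d+1}$ (together with a noise distribution). In each round $t=1,\dots,T$ the learner chooses $a_t\in\mathcal{A}$ and observes $y_t=\langle a_t,\theta\rangle+\xi_t$, where the $\xi_t$ are independent, centered, $1$-sub-Gaussian. With $a^\star=\theta/\|\theta\|$ the optimal action, the (pseudo-)regret and the hint-based regret in instance $\theta$ are $$\mathrm{Reg}^{\theta}(T)=\sum_{t=1}^T\langle\theta,a^\star-a_t\rangle,\qquad \mathrm{Reg}^{\theta}_h(T)=\sum_{t=1}^T\langle\theta,h-a_t\rangle .$$ Expectations are over the noise and the learner's randomness. "$\Theta(1)$ norm" means that the norm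 is bounded above and below by positive absolute constants; $\Omega(\cdot)$ hides a positive absolute constant.
   Formalization: T ≥ 1 is assumed, and the second inequality (≥ Ω(dT/R_h)) is stated only for d ≥ 2 and R_h ≥ κd, with constant κ/8 for every κ in (0,1]; without a condition of this kind it is false, e.g. for the learner that always plays h (R_h = 0). *)

theory Defs
  imports "HOL-Probability.Probability"
begin

text \<open>
  The action set is the closed Euclidean unit ball \<open>cball 0 1\<close>. Rounds are numbered
  \<open>0, \<dots>, T - 1\<close>. A randomized learner consists of a probability space \<open>Q\<close>, from which a seed
  is drawn once and independently of the noise, and of decision rules \<open>\<pi> t\<close> mapping the seed and
  the observations of the rounds \<open>0, \<dots>, t - 1\<close> to the action of round \<open>t\<close>. The past actions
  need not be passed on, since they are functions of the same data. The seed space is arbitrary,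
  so it can also supply fresh randomness for every round.
\<close>

definition learning_algorithm ::
    "'u measure \<Rightarrow> (nat \<Rightarrow> 'u \<times> (nat \<Rightarrow> real) \<Rightarrow> 'a::euclidean_space) \<Rightarrow> bool" where
  "learning_algorithm Q \<pi> \<longleftrightarrow>
     prob_space Q \<and>
     (\<forall>t. \<pi> t \<in> borel_measurable (Q \<Otimes>\<^sub>M (\<Pi>\<^sub>M i\<in>{..<t}. borel))) \<and>
     (\<forall>t. \<forall>x \<in> space (Q \<Otimes>\<^sub>M (\<Pi>\<^sub>M i\<in>{..<t}. (borel :: real measure))). \<pi> t x \<in> cball 0 1)"

definition centered_subgaussian :: "real measure \<Rightarrow> bool" where
  "centered_subgaussian \<nu> \<longleftrightarrow>
     prob_space \<nu> \<and> sets \<nu> = sets borel \<and>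
     integrable \<nu> (\<lambda>x. x) \<and> (\<integral>x. x \<partial>\<nu>) = 0 \<and>
     (\<forall>s. integrable \<nu> (\<lambda>x. exp (s * x)) \<and> (\<integral>x. exp (s * x) \<partial>\<nu>) \<le> exp (s\<^sup>2 / 2))"

text \<open>
  The observations made before round \<open>t\<close> in the instance \<open>\<theta>\<close>, for the seed \<open>u\<close> and the noise
  sequence \<open>\<xi>\<close>. The value is \<open>undefined\<close> outside \<open>{..<t}\<close>, as required of the points of
  a product space over \<open>{..<t}\<close>.
\<close>

primrec observations ::
    "(nat \<Rightarrow> 'u \<times> (nat \<Rightarrow> real) \<Rightarrow> 'a::euclidean_space) \<Rightarrow> 'a \<Rightarrow> 'u \<Rightarrow> (nat \<Rightarrow> real) \<Rightarrow>
     nat \<Rightarrow> (nat \<Rightarrow> real)" where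
  "observations \<pi> \<theta> u \<xi> 0 = (\<lambda>_. undefined)"
| "observations \<pi> \<theta> u \<xi> (Suc t) =
     (observations \<pi> \<theta> u \<xi> t)(t := \<pi> t (u, observations \<pi> \<theta> u \<xi> t) \<bullet> \<theta> + \<xi> t)"

definition action ::
    "(nat \<Rightarrow> 'u \<times> (nat \<Rightarrow> real) \<Rightarrow> 'a::euclidean_space) \<Rightarrow> 'a \<Rightarrow> 'u \<Rightarrow> (nat \<Rightarrow> real) \<Rightarrow>
     nat \<Rightarrow> 'a" where
  "action \<pi> \<theta> u \<xi> t = \<pi> t (u, observations \<pi> \<theta> u \<xi> t)"

definition interaction_space :: "'u measure \<Rightarrow> real measure \<Rightarrow> nat \<Rightarrow> ('u \<times> (nat \<Rightarrow> real)) measure" where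
  "interaction_space Q \<nu> T = Q \<Otimes>\<^sub>M (\<Pi>\<^sub>M t\<in>{..<T}. \<nu>)"

definition regret_against ::
    "(nat \<Rightarrow> 'u \<times> (nat \<Rightarrow> real) \<Rightarrow> 'a::euclidean_space) \<Rightarrow> nat \<Rightarrow> 'a \<Rightarrow> 'a \<Rightarrow>
     'u \<times> (nat \<Rightarrow> real) \<Rightarrow> real" where
  "regret_against \<pi> T b \<theta> = (\<lambda>(u, \<xi>). \<Sum>t<T. \<theta> \<bullet> (b - action \<pi> \<theta> u \<xi> t))"

definition best_action :: "'a::euclidean_space \<Rightarrow> 'a" where
  "best_action \<theta> = \<theta> /\<^sub>R norm \<theta>"

definition expected_regret ::
    "'u measure \<Rightarrow> (nat \<Rightarrow> 'u \<times> (nat \<Rightarrow> real) \<Rightarrow> 'a::euclidean_space) \<Rightarrow> real measure \<Rightarrow>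
     nat \<Rightarrow> 'a \<Rightarrow> real" where
  "expected_regret Q \<pi> \<nu> T \<theta> =
     (\<integral>\<omega>. regret_against \<pi> T (best_action \<theta>) \<theta> \<omega> \<partial>interaction_space Q \<nu> T)"

definition expected_hint_regret ::
    "'u measure \<Rightarrow> (nat \<Rightarrow> 'u \<times> (nat \<Rightarrow> real) \<Rightarrow> 'a::euclidean_space) \<Rightarrow> real measure \<Rightarrow>
     nat \<Rightarrow> 'a \<Rightarrow> 'a \<Rightarrow> real" where
  "expected_hint_regret Q \<pi> \<nu> T h \<theta> =
     (\<integral>\<omega>. regret_against \<pi> T h \<theta> \<omega> \<partial>interaction_space Q \<nu> T)"

definition max_hint_regret ::
    "'u measure \<Rightarrow> (nat \<Rightarrow> 'u \<times> (nat \<Rightarrow> real) \<Rightarrow> 'a::euclidean_space) \<Rightarrow> real measure \<Rightarrow>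
     nat \<Rightarrow> 'a \<Rightarrow> 'a set \<Rightarrow> real" where
  "max_hint_regret Q \<pi> \<nu> T h \<Theta> = Max (expected_hint_regret Q \<pi> \<nu> T h ` \<Theta>)"

lemma observations_in_space:
  "observations \<pi> \<theta> u \<xi> t \<in> space (\<Pi>\<^sub>M i\<in>{..<t}. (borel :: real measure))"
  by (induction t) (auto simp: space_PiM PiE_iff extensional_def)

lemma measurable_observations:
  assumes "learning_algorithm Q \<pi>" and "sets \<nu> = sets borel" and "t \<le> T"
  shows "(\<lambda>\<omega>. observations \<pi> \<theta> (fst \<omega>) (snd \<omega>) t)
    \<in> interaction_space Q \<nu> T \<rightarrow>\<^sub>M (\<Pi>\<^sub>M i\<in>{..<t}. (borel :: real measure))"
  using assms(3)
proof (induction t)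
  case 0
  show ?case
    by (auto simp: space_PiM PiM_empty)
next
  case (Suc t)
  let ?M = "interaction_space Q \<nu> T"
  have [measurable]: "\<pi> t \<in> borel_measurable (Q \<Otimes>\<^sub>M (\<Pi>\<^sub>M i\<in>{..<t}. borel))"
    using assms(1) by (simp add: learning_algorithm_def)
  have [measurable]: "(\<lambda>\<omega>. observations \<pi> \<theta> (fst \<omega>) (snd \<omega>) t)
      \<in> ?M \<rightarrow>\<^sub>M (\<Pi>\<^sub>M i\<in>{..<t}. (borel :: real measure))"
    using Suc by simp
  have [measurable]: "fst \<in> ?M \<rightarrow>\<^sub>M Q"
    by (simp add: interaction_space_def)
  have "t \<in> {..<T}"
    using Suc.prems by simp
  then have "(\<lambda>\<omega>. snd \<omega> t) \<in> ?M \<rightarrow>\<^sub>M \<nu>"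
    unfolding interaction_space_def by measurable
  then have [measurable]: "(\<lambda>\<omega>. snd \<omega> t) \<in> borel_measurable ?M"
    using measurable_cong_sets[OF refl assms(2)] by blast
  show ?case
    unfolding observations.simps lessThan_Suc
    by (rule measurable_fun_upd[where J = "{..<t}"]) (auto, measurable)
qed

lemma measurable_action:
  assumes "learning_algorithm Q \<pi>" and "sets \<nu> = sets borel" and "t \<le> T"
  shows "(\<lambda>\<omega>. action \<pi> \<theta> (fst \<omega>) (snd \<omega>) t) \<in> borel_measurable (interaction_space Q \<nu> T)"
proof -
  let ?M = "interaction_space Q \<nu> T"
  have [measurable]: "\<pi> t \<in> borel_measurable (Q \<Otimes>\<^sub>M (\<Pi>\<^sub>M i\<in>{..<t}. borel))"
    using assms(1) by (simp add: learning_algorithm_def)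
  note [measurable] = measurable_observations[OF assms]
  have [measurable]: "fst \<in> ?M \<rightarrow>\<^sub>M Q"
    by (simp add: interaction_space_def)
  show ?thesis
    unfolding action_def by measurable
qed

lemma norm_action_le:
  assumes "learning_algorithm Q \<pi>" and "\<omega> \<in> space (interaction_space Q \<nu> T)"
  shows "norm (action \<pi> \<theta> (fst \<omega>) (snd \<omega>) t) \<le> 1"
proof -
  have "(fst \<omega>, observations \<pi> \<theta> (fst \<omega>) (snd \<omega>) t)
      \<in> space (Q \<Otimes>\<^sub>M (\<Pi>\<^sub>M i\<in>{..<t}. (borel :: real measure)))"
    using assms(2) observations_in_space[of \<pi> \<theta> "fst \<omega>" "snd \<omega>" t]
    by (auto simp: interaction_space_def space_pair_measure)
  then show ?thesis
    using assms(1) by (auto simp: learning_algorithm_def action_def)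
qed

lemma integrable_regret_against:
  assumes "learning_algorithm Q \<pi>" and "centered_subgaussian \<nu>"
  shows "integrable (interaction_space Q \<nu> T) (regret_against \<pi> T b \<theta>)"
proof -
  interpret Q: prob_space Q
    using assms(1) by (simp add: learning_algorithm_def)
  interpret N: prob_space \<nu>
    using assms(2) by (simp add: centered_subgaussian_def)
  interpret P: prob_space "\<Pi>\<^sub>M t\<in>{..<T}. \<nu>"
    by (intro prob_space_PiM N.prob_space_axioms)
  interpret I: pair_prob_space Q "\<Pi>\<^sub>M t\<in>{..<T}. \<nu>" ..
  interpret M: prob_space "interaction_space Q \<nu> T"
    unfolding interaction_space_def by (rule I.prob_space_axioms)
  have "integrable (interaction_space Q \<nu> T) (\<lambda>\<omega>. action \<pi> \<theta> (fst \<omega>) (snd \<omega>) t)"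
    if "t < T" for t
  proof (rule M.integrable_const_bound[where B = 1])
    show "AE \<omega> in interaction_space Q \<nu> T. norm (action \<pi> \<theta> (fst \<omega>) (snd \<omega>) t) \<le> 1"
      using norm_action_le[OF assms(1)] by (intro AE_I2)
    show "(\<lambda>\<omega>. action \<pi> \<theta> (fst \<omega>) (snd \<omega>) t) \<in> borel_measurable (interaction_space Q \<nu> T)"
      using assms that by (intro measurable_action) (auto simp: centered_subgaussian_def)
  qed
  then show ?thesis
    unfolding regret_against_def case_prod_beta
    by (intro Bochner_Integration.integrable_sum integrable_inner_right
        Bochner_Integration.integrable_diff) auto
qed

end

theory Submission
  imports Defs
begin

text \<open>
  The family consists of the null instance \<open>c h\<close> and of the instances \<open>c h + w e\<close> and \<open>c h - w e\<close>
  for \<open>e\<close> in an orthonormal basis of the complement of \<open>h\<close>, with standard Gaussian noise. Here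
  \<open>w\<^sup>2 = c z\<close>, where \<open>z\<close> is of order \<open>d / max \<rho> (d - 1)\<close> and \<open>\<rho>\<close> is the expected regret of the
  algorithm in the null instance. As \<open>h\<close> is optimal there, \<open>\<rho> \<le> R_h\<close>.

  The component of an action orthogonal to \<open>h\<close> costs the null instance at least half its square
  times \<open>c\<close>. So \<open>\<rho>\<close> bounds the Fisher information that all directions \<open>e\<close> receive together, and
  the average direction receives only a constant amount. Under the null measure the likelihood
  ratios of \<open>c h + w e\<close> and \<open>c h - w e\<close> average to \<open>L = exp (- x / 2) * cosh S\<close>, where \<open>x\<close> is the
  information and \<open>S\<close> is the score, and the posterior risk of an action in this pair, weighted by \<open>L\<close>,
  is an explicit quadratic in the action. It is bounded below by \<open>11/20 + (ln L) / 4\<close>, up to a correction for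
  \<open>x < 20/9\<close>. The logarithm can be averaged: \<open>E ln (cosh (S + sqrt (20/9 - x) * Z))\<close>, with \<open>Z\<close> a
  Gaussian and the square root truncated at zero, does not decrease in time. Hence in each round
  the average regret over the pair is at least a constant times \<open>z\<close>, and \<open>T\<close> rounds give regret of
  order \<open>T z\<close>, that is of order \<open>d T / max \<rho> (d - 1)\<close>.

  Part of the exploration cost is charged to the null instance: it enters with weight \<open>\<kappa>\<close>, which
  is positive only in small dimension. The constants are chosen so that \<open>\<rho>\<close> or the largest regret
  exceeds the claimed bound with its exact factor \<open>1/4\<close>.
\<close>

subsection \<open>Gaussian integrals\<close>

definition gauss :: "real measure" where
  "gauss = density lborel (\<lambda>x. ennreal (std_normal_density x))"

lemma sets_gauss [measurable_cong, simp]: "sets gauss = sets borel"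
  by (simp add: gauss_def)

lemma space_gauss [simp]: "space gauss = UNIV"
  by (simp add: gauss_def)

lemma prob_space_gauss: "prob_space gauss"
  unfolding gauss_def by (rule prob_space_normal_density) simp

lemma nn_integral_gauss:
  assumes [measurable]: "f \<in> borel_measurable borel"
  shows "(\<integral>\<^sup>+z. f z \<partial>gauss) = (\<integral>\<^sup>+z. ennreal (std_normal_density z) * f z \<partial>lborel)"
  unfolding gauss_def by (rule nn_integral_density) simp_all

lemma emeasure_gauss_UNIV [simp]: "emeasure gauss UNIV = 1"
  using prob_space.emeasure_space_1[OF prob_space_gauss] by simp

text \<open>Completing the square in the Gaussian density gives the one-dimensional Cameron-Martin
  formula. It is the change of measure for a single observation.\<close>

lemma nn_integral_gauss_shift:
  assumes [measurable]: "f \<in> borel_measurable borel"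
  shows "(\<integral>\<^sup>+z. f (m + z) \<partial>gauss) = (\<integral>\<^sup>+z. f z * ennreal (exp (m * z - m\<^sup>2 / 2)) \<partial>gauss)"
proof -
  have eq: "std_normal_density (m + z) * exp (m * (m + z) - m\<^sup>2 / 2) = std_normal_density z" for z
    by (simp add: std_normal_density_def exp_add[symmetric] power2_eq_square field_simps
        flip: exp_add)
  have "(\<integral>\<^sup>+z. f z * ennreal (exp (m * z - m\<^sup>2 / 2)) \<partial>gauss)
      = (\<integral>\<^sup>+z. ennreal (std_normal_density z) * (f z * ennreal (exp (m * z - m\<^sup>2 / 2))) \<partial>lborel)"
    by (rule nn_integral_gauss) simp
  also have "\<dots> = (\<integral>\<^sup>+z. ennreal (std_normal_density (m + 1 * z)) *
      (f (m + 1 * z) * ennreal (exp (m * (m + 1 * z) - m\<^sup>2 / 2))) \<partial>lborel)"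
    by (subst nn_integral_real_affine[where t = m and c = 1]) simp_all
  also have "\<dots> = (\<integral>\<^sup>+z. ennreal (std_normal_density z) * f (m + z) \<partial>lborel)"
  proof (rule nn_integral_cong)
    fix z
    have "ennreal (std_normal_density (m + 1 * z)) *
        (f (m + 1 * z) * ennreal (exp (m * (m + 1 * z) - m\<^sup>2 / 2)))
      = ennreal (std_normal_density (m + z) * exp (m * (m + z) - m\<^sup>2 / 2)) * f (m + z)"
      by (subst ennreal_mult') (simp_all add: mult_ac)
    then show "ennreal (std_normal_density (m + 1 * z)) *
        (f (m + 1 * z) * ennreal (exp (m * (m + 1 * z) - m\<^sup>2 / 2)))
      = ennreal (std_normal_density z) * f (m + z)"
      by (simp only: eq)
  qed
  also have "\<dots> = (\<integral>\<^sup>+z. f (m + z) \<partial>gauss)"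
    by (rule nn_integral_gauss[symmetric]) simp
  finally show ?thesis by simp
qed

lemma nn_integral_gauss_exp: "(\<integral>\<^sup>+z. ennreal (exp (m * z)) \<partial>gauss) = ennreal (exp (m\<^sup>2 / 2))"
proof -
  have "(\<integral>\<^sup>+z. ennreal (exp (m * z)) \<partial>gauss)
      = (\<integral>\<^sup>+z. ennreal (exp (m\<^sup>2 / 2)) * ennreal (exp (m * z - m\<^sup>2 / 2)) \<partial>gauss)"
    by (intro nn_integral_cong) (simp flip: ennreal_mult' exp_add)
  also have "\<dots> = ennreal (exp (m\<^sup>2 / 2))"
    using nn_integral_gauss_shift[of "\<lambda>_. ennreal (exp (m\<^sup>2 / 2))" m] by simp
  finally show ?thesis .
qed

lemma nn_integral_gauss_scale:
  assumes [measurable]: "f \<in> borel_measurable borel" and "\<delta> \<noteq> 0"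
  shows "(\<integral>\<^sup>+z. f (\<delta> * z) \<partial>gauss) = (\<integral>\<^sup>+y. ennreal (normal_density 0 \<bar>\<delta>\<bar> y) * f y \<partial>lborel)"
proof -
  have "normal_density 0 \<bar>\<delta>\<bar> (\<delta> * z) * \<bar>\<delta>\<bar> = std_normal_density z" for z
    using assms(2) by (simp add: normal_density_def power_mult_distrib real_sqrt_mult field_simps)
  then have eq: "ennreal \<bar>\<delta>\<bar> * (ennreal (normal_density 0 \<bar>\<delta>\<bar> (\<delta> * z)) * f (\<delta> * z))
      = ennreal (std_normal_density z) * f (\<delta> * z)" for z
    by (metis abs_ge_zero ab_semigroup_mult_class.mult_ac(1) ennreal_mult'' mult.commute)
  have "(\<integral>\<^sup>+y. ennreal (normal_density 0 \<bar>\<delta>\<bar> y) * f y \<partial>lborel)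
      = \<bar>\<delta>\<bar> * (\<integral>\<^sup>+z. ennreal (normal_density 0 \<bar>\<delta>\<bar> (0 + \<delta> * z)) * f (0 + \<delta> * z) \<partial>lborel)"
    by (rule nn_integral_real_affine) (use assms in auto)
  also have "\<dots> = (\<integral>\<^sup>+z. ennreal (std_normal_density z) * f (\<delta> * z) \<partial>lborel)"
    by (subst nn_integral_cmult[symmetric]) (simp_all add: eq)
  also have "\<dots> = (\<integral>\<^sup>+z. f (\<delta> * z) \<partial>gauss)"
    by (rule nn_integral_gauss[symmetric]) simp
  finally show ?thesis by simp
qed

lemma nn_integral_gauss_abs:
  assumes [measurable]: "f \<in> borel_measurable borel"
  shows "(\<integral>\<^sup>+z. f (\<bar>\<delta>\<bar> * z) \<partial>gauss) = (\<integral>\<^sup>+z. f (\<delta> * z) \<partial>gauss)"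
  by (cases "\<delta> = 0") (simp_all add: nn_integral_gauss_scale)

text \<open>Fubini and a translation produce the convolution of two centered normal densities. A
  vanishing coefficient has no density and is treated apart; it occurs later when an action is
  orthogonal to the direction or when the smoothing variance is used up.\<close>

lemma nn_integral_gauss_conv:
  assumes [measurable]: "f \<in> borel_measurable borel"
  shows "(\<integral>\<^sup>+z. (\<integral>\<^sup>+z'. f (\<delta> * z + \<sigma> * z') \<partial>gauss) \<partial>gauss) = (\<integral>\<^sup>+z. f (sqrt (\<delta>\<^sup>2 + \<sigma>\<^sup>2) * z) \<partial>gauss)"
proof (cases "\<delta> = 0 \<or> \<sigma> = 0")
  case True
  then show ?thesis
    by (auto simp: nn_integral_gauss_abs)
next
  case False
  then have nz: "\<delta> \<noteq> 0" "\<sigma> \<noteq> 0" by auto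
  then have nz2: "\<delta>\<^sup>2 + \<sigma>\<^sup>2 > 0" by (simp add: add_pos_pos)
  let ?n = "\<lambda>s y. ennreal (normal_density 0 s y)"
  have "(\<integral>\<^sup>+z. (\<integral>\<^sup>+z'. f (\<delta> * z + \<sigma> * z') \<partial>gauss) \<partial>gauss)
      = (\<integral>\<^sup>+z. (\<integral>\<^sup>+y. ?n \<bar>\<sigma>\<bar> y * f (\<delta> * z + y) \<partial>lborel) \<partial>gauss)"
    using nz(2) by (simp add: nn_integral_gauss_scale[where f = "\<lambda>y. f (_ + y)"])
  also have "\<dots> = (\<integral>\<^sup>+x. ?n \<bar>\<delta>\<bar> x * (\<integral>\<^sup>+y. ?n \<bar>\<sigma>\<bar> y * f (x + y) \<partial>lborel) \<partial>lborel)"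
    using nz(1) by (rule nn_integral_gauss_scale[rotated]) measurable
  also have "\<dots> = (\<integral>\<^sup>+x. (\<integral>\<^sup>+y. ?n \<bar>\<delta>\<bar> x * (?n \<bar>\<sigma>\<bar> y * f (x + y)) \<partial>lborel) \<partial>lborel)"
    by (simp add: nn_integral_cmult)
  also have "\<dots> = (\<integral>\<^sup>+y. (\<integral>\<^sup>+x. ?n \<bar>\<delta>\<bar> x * (?n \<bar>\<sigma>\<bar> y * f (x + y)) \<partial>lborel) \<partial>lborel)"
    by (rule lborel_pair.Fubini') measurable
  also have "\<dots> = (\<integral>\<^sup>+y. (\<integral>\<^sup>+x. ?n \<bar>\<delta>\<bar> (x - y) * (?n \<bar>\<sigma>\<bar> y * f x) \<partial>lborel) \<partial>lborel)"
  proof (rule nn_integral_cong)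
    fix y
    show "(\<integral>\<^sup>+x. ?n \<bar>\<delta>\<bar> x * (?n \<bar>\<sigma>\<bar> y * f (x + y)) \<partial>lborel)
        = (\<integral>\<^sup>+x. ?n \<bar>\<delta>\<bar> (x - y) * (?n \<bar>\<sigma>\<bar> y * f x) \<partial>lborel)"
      by (subst nn_integral_real_affine[where c = 1 and t = "- y"]) simp_all
  qed
  also have "\<dots> = (\<integral>\<^sup>+x. (\<integral>\<^sup>+y. ?n \<bar>\<delta>\<bar> (x - y) * (?n \<bar>\<sigma>\<bar> y * f x) \<partial>lborel) \<partial>lborel)"
    by (rule lborel_pair.Fubini') measurable
  also have "\<dots> = (\<integral>\<^sup>+x. (\<integral>\<^sup>+y. ennreal (normal_density 0 \<bar>\<delta>\<bar> (x - y) * normal_density 0 \<bar>\<sigma>\<bar> y) \<partial>lborel) * f x \<partial>lborel)"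
    by (intro nn_integral_cong, subst nn_integral_multc[symmetric]) (simp_all add: ennreal_mult' mult_ac)
  also have "\<dots> = (\<integral>\<^sup>+x. ?n (sqrt (\<delta>\<^sup>2 + \<sigma>\<^sup>2)) x * f x \<partial>lborel)"
    using conv_normal_density_zero_mean[of "\<bar>\<delta>\<bar>" "\<bar>\<sigma>\<bar>"] nz
    by (intro nn_integral_cong) (simp add: fun_eq_iff)
  also have "\<dots> = (\<integral>\<^sup>+z. f (sqrt (\<delta>\<^sup>2 + \<sigma>\<^sup>2) * z) \<partial>gauss)"
    using nz nz2 by (subst nn_integral_gauss_scale) auto
  finally show ?thesis .
qed

lemma centered_subgaussian_gauss: "centered_subgaussian gauss"
proof -
  interpret prob_space gauss by (rule prob_space_gauss)
  have mean: "has_bochner_integral gauss (\<lambda>x. x) 0"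
    unfolding gauss_def
    by (rule has_bochner_integral_density)
       (use normal_moment_nz_1[where \<mu> = 0 and \<sigma> = 1] in \<open>auto simp: scaleR_conv_of_real\<close>)
  have "integrable gauss (\<lambda>x. exp (s * x))" for s
    by (rule integrableI_nonneg) (auto simp: nn_integral_gauss_exp)
  moreover have "(\<integral>x. exp (s * x) \<partial>gauss) = exp (s\<^sup>2 / 2)" for s
    by (subst integral_eq_nn_integral) (auto simp: nn_integral_gauss_exp)
  ultimately show ?thesis
    using mean by (auto simp: centered_subgaussian_def has_bochner_integral_iff prob_space_axioms)
qed

subsection \<open>The Gaussian smoothing of \<open>ln cosh\<close>\<close>

text \<open>Equivalent to \<open>cosh y \<le> exp (y\<^sup>2 / 2)\<close>. The logarithm of the left
  side has derivative \<open>tanh y\<close>, which is at most \<open>y\<close> for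
  \<open>y \<ge> 0\<close>.\<close>

lemma sech_sq_ge_exp: "exp (- y\<^sup>2) \<le> 1 / (cosh y)\<^sup>2" for y :: real
proof -
  have nonneg: "cosh y \<le> exp (y\<^sup>2 / 2)" if "y \<ge> 0" for y :: real
  proof -
    have d1: "sinh y \<le> y * cosh y" if "y \<ge> 0" for y :: real
    proof -
      have "0 * cosh 0 - sinh 0 \<le> y * cosh y - sinh y"
        using that
        by (intro DERIV_nonneg_imp_nondecreasing[where f = "\<lambda>y. y * cosh y - sinh y"])
           (auto intro!: derivative_eq_intros exI)
      then show ?thesis by simp
    qed
    have "0\<^sup>2 / 2 - ln (cosh 0) \<le> y\<^sup>2 / 2 - ln (cosh y)"
    proof (rule DERIV_nonneg_imp_nondecreasing[where f = "\<lambda>y. y\<^sup>2 / 2 - ln (cosh y)", OF that])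
      fix x :: real assume "0 \<le> x" "x \<le> y"
      have "((\<lambda>y. y\<^sup>2 / 2 - ln (cosh y)) has_real_derivative (x - sinh x / cosh x)) (at x)"
        by (auto intro!: derivative_eq_intros)
      moreover have "x - sinh x / cosh x \<ge> 0"
        using d1[OF \<open>0 \<le> x\<close>] by (simp add: field_simps)
      ultimately show "\<exists>D. ((\<lambda>y. y\<^sup>2 / 2 - ln (cosh y)) has_real_derivative D) (at x) \<and> 0 \<le> D"
        by blast
    qed
    then have "ln (cosh y) \<le> y\<^sup>2 / 2" by simp
    then show ?thesis
      by (metis cosh_real_pos exp_le_cancel_iff exp_ln)
  qed
  have "cosh y \<le> exp (y\<^sup>2 / 2)"
    using nonneg[of "\<bar>y\<bar>"] by simp
  then have "(cosh y)\<^sup>2 \<le> (exp (y\<^sup>2 / 2))\<^sup>2"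
    by (intro power_mono) auto
  also have "\<dots> = exp (y\<^sup>2)"
    by (simp flip: exp_double)
  finally show ?thesis
    by (simp add: exp_minus field_simps)
qed

text \<open>The heat semigroup applied to \<open>ln cosh\<close> at time
  \<open>\<sigma>\<^sup>2\<close>. Since \<open>ln cosh\<close> is nonnegative, values in
  \<open>ennreal\<close> lose nothing and spare all integrability arguments.\<close>

definition smoothed_ln_cosh :: "real \<Rightarrow> real \<Rightarrow> ennreal" where
  "smoothed_ln_cosh s \<sigma> = (\<integral>\<^sup>+z. ennreal (ln (cosh (s + \<sigma> * z))) \<partial>gauss)"

lemma borel_measurable_cosh [measurable]: "(cosh :: real \<Rightarrow> real) \<in> borel_measurable borel"
  by (intro borel_measurable_continuous_onI continuous_intros)

lemma borel_measurable_smoothed_ln_cosh [measurable]: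
  assumes [measurable]: "f \<in> borel_measurable M" "g \<in> borel_measurable M"
  shows "(\<lambda>x. smoothed_ln_cosh (f x) (g x)) \<in> borel_measurable M"
proof -
  interpret sigma_finite_measure gauss
    using prob_space_gauss prob_space_imp_sigma_finite by blast
  show ?thesis unfolding smoothed_ln_cosh_def by measurable
qed

lemma ln_cosh_nonneg: "0 \<le> ln (cosh y)" for y :: real
  by (simp add: cosh_real_ge_1)

lemma smoothed_ln_cosh_conv: "(\<integral>\<^sup>+z. smoothed_ln_cosh (s + \<delta> * z) \<sigma> \<partial>gauss) = smoothed_ln_cosh s (sqrt (\<delta>\<^sup>2 + \<sigma>\<^sup>2))"
  unfolding smoothed_ln_cosh_def
  by (subst nn_integral_gauss_conv[symmetric]) (simp_all add: add.assoc)

text \<open>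
  Symmetrization in \<open>z\<close> turns the integrand into \<open>ln (cosh (s + \<sigma> z) * cosh (s - \<sigma> z)) / 2\<close>, which is
  monotone in \<open>\<bar>\<sigma>\<bar>\<close> for each \<open>z\<close> separately.
\<close>

lemma smoothed_ln_cosh_mono:
  assumes "\<bar>\<sigma>\<bar> \<le> \<bar>\<tau>\<bar>"
  shows "smoothed_ln_cosh s \<sigma> \<le> smoothed_ln_cosh s \<tau>"
proof -
  have sym: "smoothed_ln_cosh s \<sigma> + smoothed_ln_cosh s \<sigma>
      = (\<integral>\<^sup>+z. ennreal (ln ((cosh (2 * s) + cosh (2 * (\<sigma> * z))) / 2)) \<partial>gauss)" for \<sigma>
  proof -
    have "smoothed_ln_cosh s \<sigma> = smoothed_ln_cosh s (- \<sigma>)"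
      unfolding smoothed_ln_cosh_def
      using nn_integral_gauss_abs[of "\<lambda>y. ennreal (ln (cosh (s + y)))" \<sigma>]
        nn_integral_gauss_abs[of "\<lambda>y. ennreal (ln (cosh (s + y)))" "- \<sigma>"] by simp
    then have "smoothed_ln_cosh s \<sigma> + smoothed_ln_cosh s \<sigma> = smoothed_ln_cosh s \<sigma> + smoothed_ln_cosh s (- \<sigma>)" by simp
    also have "\<dots> = (\<integral>\<^sup>+z. ennreal (ln (cosh (s + \<sigma> * z))) + ennreal (ln (cosh (s + - \<sigma> * z))) \<partial>gauss)"
      unfolding smoothed_ln_cosh_def by (rule nn_integral_add[symmetric]) measurable
    also have "\<dots> = (\<integral>\<^sup>+z. ennreal (ln ((cosh (2 * s) + cosh (2 * (\<sigma> * z))) / 2)) \<partial>gauss)"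
    proof (rule nn_integral_cong)
      fix z
      have "cosh (s + \<sigma> * z) * cosh (s - \<sigma> * z) = (cosh (2 * s) + cosh (2 * (\<sigma> * z))) / 2"
        unfolding cosh_add cosh_diff cosh_double
        using cosh_square_eq[of s] cosh_square_eq[of "\<sigma> * z"] by algebra
      then have "ln (cosh (s + \<sigma> * z)) + ln (cosh (s - \<sigma> * z))
          = ln ((cosh (2 * s) + cosh (2 * (\<sigma> * z))) / 2)"
        by (metis cosh_real_nonzero ln_mult)
      then show "ennreal (ln (cosh (s + \<sigma> * z))) + ennreal (ln (cosh (s + - \<sigma> * z)))
          = ennreal (ln ((cosh (2 * s) + cosh (2 * (\<sigma> * z))) / 2))"
        by (simp add: ln_cosh_nonneg flip: ennreal_plus)
    qed
    finally show ?thesis .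
  qed
  have "smoothed_ln_cosh s \<sigma> + smoothed_ln_cosh s \<sigma> \<le> smoothed_ln_cosh s \<tau> + smoothed_ln_cosh s \<tau>"
    unfolding sym
  proof (intro nn_integral_mono ennreal_leI)
    fix z
    have "\<bar>\<sigma> * z\<bar> \<le> \<bar>\<tau> * z\<bar>"
      using assms by (simp add: abs_mult mult_right_mono)
    then have "cosh (2 * (\<sigma> * z)) \<le> cosh (2 * (\<tau> * z))"
      using cosh_real_nonneg_le_iff[of "\<bar>2 * (\<sigma> * z)\<bar>" "\<bar>2 * (\<tau> * z)\<bar>"] by simp
    moreover have "cosh (2 * s) + cosh (2 * (\<sigma> * z)) > 0"
      by (simp add: add_pos_pos)
    ultimately show "ln ((cosh (2 * s) + cosh (2 * (\<sigma> * z))) / 2)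
        \<le> ln ((cosh (2 * s) + cosh (2 * (\<tau> * z))) / 2)"
      by (subst ln_le_cancel_iff) (auto simp: add_pos_pos)
  qed
  then show ?thesis
    by (metis add_mono_ennreal add_strict_mono linorder_not_le order_less_le_trans order_less_irrefl
        ennreal_add_less_top add_strict_mono)
qed

lemma nn_integral_gauss_cosh:
  "(\<integral>\<^sup>+z. ennreal (cosh (s + \<sigma> * z)) \<partial>gauss) = ennreal (cosh s * exp (\<sigma>\<^sup>2 / 2))"
proof -
  have "(\<integral>\<^sup>+z. ennreal (cosh (s + \<sigma> * z)) \<partial>gauss)
      = (\<integral>\<^sup>+z. ennreal (exp s / 2) * ennreal (exp (\<sigma> * z))
          + ennreal (exp (- s) / 2) * ennreal (exp (- \<sigma> * z)) \<partial>gauss)"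
    by (intro nn_integral_cong)
       (simp add: cosh_field_def exp_add exp_diff exp_minus field_simps flip: ennreal_plus ennreal_mult')
  also have "\<dots> = ennreal (exp s / 2) * ennreal (exp (\<sigma>\<^sup>2 / 2))
      + ennreal (exp (- s) / 2) * ennreal (exp (\<sigma>\<^sup>2 / 2))"
    using nn_integral_gauss_exp[of \<sigma>] nn_integral_gauss_exp[of "- \<sigma>"]
    by (simp add: nn_integral_add nn_integral_cmult)
  also have "\<dots> = ennreal (cosh s * exp (\<sigma>\<^sup>2 / 2))"
    by (simp add: cosh_field_def field_simps flip: ennreal_plus ennreal_mult')
  finally show ?thesis .
qed

text \<open>Jensen's inequality, by the tangent of \<open>ln\<close> at the mean \<open>A\<close> of
  \<open>cosh (s + \<sigma> * z)\<close>. The 1 stays on the left until the end because subtraction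
  in \<open>ennreal\<close> is truncated.\<close>

lemma smoothed_ln_cosh_upper: "smoothed_ln_cosh s \<sigma> \<le> ennreal (ln (cosh s) + \<sigma>\<^sup>2 / 2)"
proof -
  define A where "A = cosh s * exp (\<sigma>\<^sup>2 / 2)"
  have A: "A > 0" "ln A = ln (cosh s) + \<sigma>\<^sup>2 / 2" "ln A \<ge> 0"
    unfolding A_def by (simp_all add: ln_mult ln_cosh_nonneg)
  have "smoothed_ln_cosh s \<sigma> + 1 = (\<integral>\<^sup>+z. ennreal (ln (cosh (s + \<sigma> * z))) + 1 \<partial>gauss)"
    unfolding smoothed_ln_cosh_def by (simp add: nn_integral_add)
  also have "\<dots> \<le> (\<integral>\<^sup>+z. ennreal (1 / A) * ennreal (cosh (s + \<sigma> * z)) + ennreal (ln A) \<partial>gauss)"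
  proof (rule nn_integral_mono)
    fix z
    have "ln (cosh (s + \<sigma> * z) / A) \<le> cosh (s + \<sigma> * z) / A - 1"
      using A(1) by (intro ln_le_minus_one) simp
    then have "ln (cosh (s + \<sigma> * z)) + 1 \<le> 1 / A * cosh (s + \<sigma> * z) + ln A"
      using A(1) by (simp add: ln_div)
    then show "ennreal (ln (cosh (s + \<sigma> * z))) + 1
        \<le> ennreal (1 / A) * ennreal (cosh (s + \<sigma> * z)) + ennreal (ln A)"
      using A by (simp add: ln_cosh_nonneg flip: ennreal_plus ennreal_mult' ennreal_1)
  qed
  also have "\<dots> = ennreal (1 / A) * ennreal A + ennreal (ln A)"
    unfolding A_def by (simp add: nn_integral_add nn_integral_cmult nn_integral_gauss_cosh)
  also have "\<dots> = ennreal (ln A) + 1"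
    using A(1) by (simp add: add.commute flip: ennreal_mult')
  finally have "smoothed_ln_cosh s \<sigma> \<le> ennreal (ln A)"
    by (subst (asm) add.commute, subst (asm) (2) add.commute) simp
  then show ?thesis using A(2) by simp
qed

text \<open>The weight turns the standard density into \<open>\<sigma>\<close> times a normal
  density of variance \<open>\<sigma>\<^sup>2 = 1 / (1 + 2 * p)\<close>; the second moment
  contributes the remaining factor \<open>\<sigma>\<^sup>2\<close>.\<close>

lemma nn_integral_gauss_sq_exp:
  assumes "p \<ge> 0"
  shows "(\<integral>\<^sup>+z. ennreal (z\<^sup>2 * exp (- p * z\<^sup>2)) \<partial>gauss) = ennreal (1 / (sqrt (1 + 2 * p)) ^ 3)"
proof -
  define \<sigma> where "\<sigma> = 1 / sqrt (1 + 2 * p)"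
  have \<sigma>: "\<sigma> > 0" "\<sigma>\<^sup>2 = 1 / (1 + 2 * p)"
    using assms by (simp_all add: \<sigma>_def power_divide)
  have dens: "std_normal_density z * (z\<^sup>2 * exp (- p * z\<^sup>2)) = \<sigma> * (normal_density 0 \<sigma> z * (z - 0) ^ (2 * 1))" for z
  proof -
    have e: "exp (- z\<^sup>2 / 2) * exp (- p * z\<^sup>2) = exp (- (z - 0)\<^sup>2 / (2 * \<sigma>\<^sup>2))"
      using assms by (simp add: \<sigma>(2) field_simps flip: exp_add)
    have "sqrt (2 * pi * \<sigma>\<^sup>2) = sqrt (2 * pi) * \<sigma>"
      using \<sigma>(1) by (simp add: real_sqrt_mult)
    then show ?thesis
      using \<sigma>(1) e by (simp add: normal_density_def field_simps power2_eq_square)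
  qed
  have "(\<integral>\<^sup>+z. ennreal (z\<^sup>2 * exp (- p * z\<^sup>2)) \<partial>gauss)
      = (\<integral>\<^sup>+z. ennreal (\<sigma> * (normal_density 0 \<sigma> z * (z - 0) ^ (2 * 1))) \<partial>lborel)"
    by (subst nn_integral_gauss, simp, intro nn_integral_cong, subst ennreal_mult'[symmetric])
       (simp_all only: dens normal_density_nonneg)
  also have "\<dots> = ennreal (\<sigma> * (fact (2 * 1) / ((2 / \<sigma>\<^sup>2) ^ 1 * fact 1)))"
    using has_bochner_integral_mult_right[OF normal_moment_even[OF \<sigma>(1), of 0 1], of \<sigma>] \<sigma>(1)
    by (subst nn_integral_eq_integral) (auto simp: has_bochner_integral_iff)
  also have "\<sigma> * (fact (2 * 1) / ((2 / \<sigma>\<^sup>2) ^ 1 * fact 1)) = 1 / (sqrt (1 + 2 * p)) ^ 3"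
    by (simp add: \<sigma>_def field_simps power3_eq_cube power2_eq_square)
  finally show ?thesis .
qed

text \<open>
  By Taylor's formula \<open>ln (cosh y)\<close> is the integral of \<open>(1 - t) * y\<^sup>2 / (cosh (t * y))\<^sup>2\<close> over \<open>[0, 1]\<close>.
  After the bound of the squared hyperbolic secant by \<open>exp (- (t * y)\<^sup>2)\<close> both integrals are elementary.
\<close>

lemma smoothed_ln_cosh_lower: "ennreal ((sqrt (1 + 2 * \<sigma>\<^sup>2) - 1) / 2) \<le> smoothed_ln_cosh 0 \<sigma>"
proof -
  have taylor: "ennreal (ln (cosh y))
      = (\<integral>\<^sup>+t. ennreal ((1 - t) * y\<^sup>2 / (cosh (t * y))\<^sup>2) * indicator {0..1} t \<partial>lborel)" for y :: real
  proof -
    define F where "F t = (1 - t) * y * tanh (t * y) + ln (cosh (t * y))" for t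
    have "(\<integral>\<^sup>+t. ennreal ((1 - t) * y\<^sup>2 / (cosh (t * y))\<^sup>2) * indicator {0..1} t \<partial>lborel)
        = ennreal (F 1 - F 0)"
    proof (rule nn_integral_FTC_Icc)
      fix t :: real
      have "((\<lambda>t. (1 - t) * y * (sinh (t * y) / cosh (t * y)) + ln (cosh (t * y))) has_real_derivative
          (1 - t) * y\<^sup>2 / (cosh (t * y))\<^sup>2) (at t)"
        using cosh_square_eq[of "t * y"]
        by (auto intro!: derivative_eq_intros simp: field_simps power2_eq_square)
      then show "(F has_real_derivative (1 - t) * y\<^sup>2 / (cosh (t * y))\<^sup>2) (at t)"
        unfolding F_def[abs_def] tanh_def .
    qed (auto simp: F_def)
    then show ?thesis by (simp add: F_def)
  qed
  \<comment> \<open>\<open>g t\<close> is the Gaussian mean of \<open>(1 - t) * (\<sigma> *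
    z)\<^sup>2 * exp (- (t * \<sigma> * z)\<^sup>2)\<close>, and \<open>G\<close> is an
    antiderivative of \<open>g\<close>.\<close>
  define G where "G t = \<sigma>\<^sup>2 * t / sqrt (1 + 2 * \<sigma>\<^sup>2 * t\<^sup>2) + 1 / (2 * sqrt (1 + 2 * \<sigma>\<^sup>2 * t\<^sup>2))" for t
  define g where "g t = (1 - t) * \<sigma>\<^sup>2 / (sqrt (1 + 2 * \<sigma>\<^sup>2 * t\<^sup>2)) ^ 3" for t
  have pos: "1 + 2 * \<sigma>\<^sup>2 * t\<^sup>2 > 0" for t :: real
    by (smt (verit) zero_le_mult_iff zero_le_power2)
  have "(sqrt (1 + 2 * \<sigma>\<^sup>2) - 1) / 2 = G 1 - G 0"
  proof -
    have "sqrt (1 + 2 * \<sigma>\<^sup>2) > 0" using pos[of 1] by simp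
    then show ?thesis
      using real_sqrt_pow2[of "1 + 2 * \<sigma>\<^sup>2"] pos[of 1]
      by (simp add: G_def field_simps power2_eq_square)
  qed
  also have "ennreal (G 1 - G 0) = (\<integral>\<^sup>+t. ennreal (g t) * indicator {0..1} t \<partial>lborel)"
  proof (rule nn_integral_FTC_Icc[symmetric])
    fix t :: real
    define r where "r = sqrt (1 + 2 * \<sigma>\<^sup>2 * t\<^sup>2)"
    have r: "r > 0" "r\<^sup>2 = 1 + 2 * \<sigma>\<^sup>2 * t\<^sup>2"
      using pos[of t] by (auto simp: r_def)
    have dR: "((\<lambda>t. sqrt (1 + 2 * \<sigma>\<^sup>2 * t\<^sup>2)) has_real_derivative 2 * \<sigma>\<^sup>2 * t / r) (at t)"
      unfolding r_def using pos[of t] by (auto intro!: derivative_eq_intros simp: field_simps)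
    have "(G has_real_derivative
        (\<sigma>\<^sup>2 * r - \<sigma>\<^sup>2 * t * (2 * \<sigma>\<^sup>2 * t / r)) / r\<^sup>2 - (2 * \<sigma>\<^sup>2 * t / r) / (2 * r\<^sup>2)) (at t)"
    proof -
      have "((\<lambda>t. \<sigma>\<^sup>2 * t / R t + 1 / (2 * R t)) has_real_derivative
          (\<sigma>\<^sup>2 * R t - \<sigma>\<^sup>2 * t * D) / (R t)\<^sup>2 - D / (2 * (R t)\<^sup>2)) (at t)"
        if "(R has_real_derivative D) (at t)" "R t > 0" for R :: "real \<Rightarrow> real" and D
        using that by (auto intro!: derivative_eq_intros simp: field_simps power2_eq_square)
      from this[OF dR] show ?thesis
        using r(1) unfolding G_def[abs_def] r_def by simp
    qed
    moreover have "(\<sigma>\<^sup>2 * r - \<sigma>\<^sup>2 * t * (2 * \<sigma>\<^sup>2 * t / r)) / r\<^sup>2 - (2 * \<sigma>\<^sup>2 * t / r) / (2 * r\<^sup>2) = g t"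
    proof -
      have "(\<sigma>\<^sup>2 * r - \<sigma>\<^sup>2 * t * (2 * \<sigma>\<^sup>2 * t / r)) / r\<^sup>2 - (2 * \<sigma>\<^sup>2 * t / r) / (2 * r\<^sup>2)
          = (\<sigma>\<^sup>2 * (r\<^sup>2 - 2 * \<sigma>\<^sup>2 * t\<^sup>2) - \<sigma>\<^sup>2 * t) / r ^ 3"
        using r(1) by (simp add: field_simps power2_eq_square power3_eq_cube)
      moreover have "r\<^sup>2 - 2 * \<sigma>\<^sup>2 * t\<^sup>2 = 1"
        using r(2) by simp
      moreover have "g t = (\<sigma>\<^sup>2 * 1 - \<sigma>\<^sup>2 * t) / r ^ 3"
        unfolding g_def r_def by (simp add: left_diff_distrib mult.commute)
      ultimately show ?thesis by simp
    qed
    ultimately show "(G has_real_derivative g t) (at t)"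
      by simp
  qed (use pos in \<open>auto simp: g_def intro!: divide_nonneg_nonneg mult_nonneg_nonneg\<close>)
  also have "\<dots> \<le> (\<integral>\<^sup>+t. (\<integral>\<^sup>+z. ennreal ((1 - t) * (\<sigma> * z)\<^sup>2 / (cosh (t * (\<sigma> * z)))\<^sup>2)
      * indicator {0..1} t \<partial>gauss) \<partial>lborel)"
  proof (rule nn_integral_mono)
    fix t :: real
    show "ennreal (g t) * indicator {0..1} t
        \<le> (\<integral>\<^sup>+z. ennreal ((1 - t) * (\<sigma> * z)\<^sup>2 / (cosh (t * (\<sigma> * z)))\<^sup>2) * indicator {0..1} t \<partial>gauss)"
    proof (cases "t \<in> {0..1}")
      case True
      have "ennreal (g t) = ennreal ((1 - t) * \<sigma>\<^sup>2) * ennreal (1 / (sqrt (1 + 2 * (t\<^sup>2 * \<sigma>\<^sup>2))) ^ 3)"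
        using True by (simp add: g_def mult_ac flip: ennreal_mult')
      also have "\<dots> = (\<integral>\<^sup>+z. ennreal ((1 - t) * \<sigma>\<^sup>2) * ennreal (z\<^sup>2 * exp (- (t\<^sup>2 * \<sigma>\<^sup>2) * z\<^sup>2)) \<partial>gauss)"
        by (subst nn_integral_gauss_sq_exp[symmetric]) (simp_all add: nn_integral_cmult)
      also have "\<dots> \<le> (\<integral>\<^sup>+z. ennreal ((1 - t) * (\<sigma> * z)\<^sup>2 / (cosh (t * (\<sigma> * z)))\<^sup>2) \<partial>gauss)"
      proof (rule nn_integral_mono)
        fix z
        have "(1 - t) * \<sigma>\<^sup>2 * (z\<^sup>2 * exp (- (t * (\<sigma> * z))\<^sup>2))
            \<le> (1 - t) * \<sigma>\<^sup>2 * (z\<^sup>2 * (1 / (cosh (t * (\<sigma> * z)))\<^sup>2))"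
          using True sech_sq_ge_exp[of "t * (\<sigma> * z)"] by (intro mult_left_mono) auto
        then show "ennreal ((1 - t) * \<sigma>\<^sup>2) * ennreal (z\<^sup>2 * exp (- (t\<^sup>2 * \<sigma>\<^sup>2) * z\<^sup>2))
            \<le> ennreal ((1 - t) * (\<sigma> * z)\<^sup>2 / (cosh (t * (\<sigma> * z)))\<^sup>2)"
          using True
          by (simp add: power_mult_distrib mult_ac flip: ennreal_mult')
      qed
      finally show ?thesis using True by simp
    qed simp
  qed
  also have "\<dots> = (\<integral>\<^sup>+z. (\<integral>\<^sup>+t. ennreal ((1 - t) * (\<sigma> * z)\<^sup>2 / (cosh (t * (\<sigma> * z)))\<^sup>2)
      * indicator {0..1} t \<partial>lborel) \<partial>gauss)"
  proof -
    interpret g: prob_space gauss by (rule prob_space_gauss)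
    interpret pair_sigma_finite lborel gauss ..
    show ?thesis by (rule Fubini'[symmetric]) measurable
  qed
  also have "\<dots> = smoothed_ln_cosh 0 \<sigma>"
    unfolding smoothed_ln_cosh_def by (simp add: taylor)
  finally show ?thesis .
qed

subsection \<open>The potential and the posterior risk\<close>

lemma ln_le_tangent_exp: "ln l \<le> l * exp (- k) - 1 + k" if "0 < l" for l k :: real
  using ln_le_minus_one[of "l * exp (- k)"] that by (simp add: ln_mult)

lemma exp_bounds:
  "exp 1 \<le> ((27183/10000) :: real)" "(1359/500) \<le> exp (1 :: real)"
  "exp (1/2) \<le> ((2061/1250) :: real)" "(8243/5000) \<le> exp (1/2 :: real)"
  "exp (5/4) \<le> ((8727/2500) :: real)" "exp (3/2) \<le> ((22411/5000) :: real)"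
  "exp 2 \<le> ((18473/2500) :: real)" "(7387/1000) \<le> exp (2 :: real)" "(109/2) \<le> exp (4 :: real)" "148 \<le> exp (5 :: real)"
proof -
  have "\<bar>exp 1 - 5837465777 / 2147483648\<bar> \<le> (1 / 4294967296 :: real)"
    using e_approx_32 by simp
  then have e: "exp (1::real) \<in> {(13591/5000)..(27183/10000)}"
    unfolding abs_le_iff atLeastAtMost_iff by simp
  have p: "exp (of_nat n * x) = exp x ^ n" for n and x :: real
    by (rule exp_of_nat_mult)
  show e1: "exp 1 \<le> ((27183/10000) :: real)" and e1': "(1359/500) \<le> exp (1 :: real)"
    using e by auto
  show "exp (1/2) \<le> ((2061/1250) :: real)" "(8243/5000) \<le> exp (1/2 :: real)"
    using power2_le_imp_le[of "exp (1/2)" "(2061/1250)::real"] power2_le_imp_le[of "(8243/5000)::real" "exp (1/2)"]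
      p[of 2 "1/2"] e by (auto simp: power2_eq_square)
  show "exp (5/4) \<le> ((8727/2500) :: real)"
  proof (rule power_le_imp_le_base)
    have "exp (5/4) ^ Suc 3 = exp (1::real) ^ 5"
      using p[of 4 "5/4"] p[of 5 1] by simp
    also have "\<dots> \<le> (27183/10000) ^ 5" by (rule power_mono[OF e1]) simp
    also have "\<dots> \<le> (8727/2500) ^ Suc 3" by (simp add: power_divide eval_nat_numeral)
    finally show "exp (5/4) ^ Suc 3 \<le> ((8727/2500) :: real) ^ Suc 3" .
  qed simp
  show "exp (3/2) \<le> ((22411/5000) :: real)"
  proof (rule power_le_imp_le_base)
    have "exp (3/2) ^ Suc 1 = exp (1::real) ^ 3"
      using p[of 2 "3/2"] p[of 3 1] by (simp add: power2_eq_square)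
    also have "\<dots> \<le> (27183/10000) ^ 3" by (rule power_mono[OF e1]) simp
    also have "\<dots> \<le> (22411/5000) ^ Suc 1" by (simp add: power_divide eval_nat_numeral)
    finally show "exp (3/2) ^ Suc 1 \<le> ((22411/5000) :: real) ^ Suc 1" .
  qed simp
  have "exp 1 ^ 2 \<le> ((27183/10000) :: real) ^ 2" by (rule power_mono[OF e1]) simp
  then show "exp 2 \<le> ((18473/2500) :: real)" using p[of 2 1] by (simp add: power2_eq_square)
  have "(1359/500) ^ n \<le> exp (1 :: real) ^ n" for n by (rule power_mono[OF e1']) simp
  from this[of 2] this[of 4] this[of 5]
  show "(7387/1000) \<le> exp (2 :: real)" "(109/2) \<le> exp (4 :: real)" "148 \<le> exp (5 :: real)"
    using p[of 2 1] p[of 4 1] p[of 5 1] by (simp_all add: power_divide eval_nat_numeral)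
qed

text \<open>Tangents of \<open>ln\<close> at \<open>exp k\<close> for \<open>k\<close> = -2, -3/2,
  -1, -1/2, -5/4, 1/2, 1, 2, 4, 5, in this order, with slopes rounded up to rationals.\<close>

lemma ln_le_affine:
  fixes l :: real
  assumes "0 < l"
  shows "ln l \<le> (18473/2500) * l - 3" "ln l \<le> (22411/5000) * l - 5/2" "ln l \<le> (27183/10000) * l - 2" "ln l \<le> (2061/1250) * l - 3/2"
    "ln l \<le> (8727/2500) * l - 9/4" "ln l \<le> l / (8243/5000) - 1/2" "ln l \<le> l / (1359/500)" "ln l \<le> l / (7387/1000) + 1"
    "ln l \<le> l / (109/2) + 3" "ln l \<le> l / 148 + 4"
proof -
  have up: "ln l \<le> q * l - 1 - k" if "exp k \<le> q" for k q
    using ln_le_tangent_exp[OF assms, of "- k"] mult_left_mono[OF that, of l] assms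
    by (smt (verit) mult.commute mult_left_mono)
  have lo: "ln l \<le> l / q - 1 + k" if "q \<le> exp k" "0 < q" for k q
  proof -
    have "l / exp k \<le> l / q" using assms that by (intro divide_left_mono) auto
    then show ?thesis using ln_le_tangent_exp[OF assms, of k] by (simp add: exp_minus divide_inverse)
  qed
  show "ln l \<le> (18473/2500) * l - 3" using up[OF exp_bounds(7)] by simp
  show "ln l \<le> (22411/5000) * l - 5/2" using up[OF exp_bounds(6)] by simp
  show "ln l \<le> (27183/10000) * l - 2" using up[OF exp_bounds(1)] by simp
  show "ln l \<le> (2061/1250) * l - 3/2" using up[OF exp_bounds(3)] by simp
  show "ln l \<le> (8727/2500) * l - 9/4" using up[OF exp_bounds(5)] by simp
  show "ln l \<le> l / (8243/5000) - 1/2" using lo[OF exp_bounds(4)] by simp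
  show "ln l \<le> l / (1359/500)" using lo[OF exp_bounds(2)] by simp
  show "ln l \<le> l / (7387/1000) + 1" using lo[OF exp_bounds(8)] by simp
  show "ln l \<le> l / (109/2) + 3" using lo[OF exp_bounds(9)] by simp
  show "ln l \<le> l / 148 + 4" using lo[OF exp_bounds(10)] by simp
qed

lemma quadratic_nonpos_between:
  fixes p q r x :: real
  assumes "p \<ge> 0" "u \<le> x" "x \<le> v" "p * u\<^sup>2 + q * u + r \<le> 0" "p * v\<^sup>2 + q * v + r \<le> 0"
  shows "p * x\<^sup>2 + q * x + r \<le> 0"
proof (cases "u = v")
  case False
  then have uv: "v - u > 0" using assms by simp
  have "(v - u) * (p * x\<^sup>2 + q * x + r)
      = (v - x) * (p * u\<^sup>2 + q * u + r) + (x - u) * (p * v\<^sup>2 + q * v + r) - p * (v - u) * ((x - u) * (v - x))"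
    by algebra
  also have "\<dots> \<le> 0"
    using assms by (smt (verit) mult_nonneg_nonneg mult_nonneg_nonpos uv)
  finally show ?thesis using uv by (simp add: mult_le_0_iff)
qed (use assms in auto)

text \<open>
  The logarithms are replaced by tangents on pieces of the line. On each piece this lemma reduces
  the claim to the two endpoints, since it amounts to the sign of a convex quadratic.
\<close>

lemma affine_le_saturating:
  fixes p q l u v :: real
  assumes "q \<ge> 0" "0 \<le> u" "u \<le> l" "l \<le> v"
    and "q * u\<^sup>2 + (p + 9/5 * q - 9/5) * u + 9/5 * p \<le> 0" "q * v\<^sup>2 + (p + 9/5 * q - 9/5) * v + 9/5 * p \<le> 0"
  shows "p + q * l \<le> 9/5 * l / (9/5 + l)"
proof -
  have "q * l\<^sup>2 + (p + 9/5 * q - 9/5) * l + 9/5 * p \<le> 0"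
    by (rule quadratic_nonpos_between[OF assms(1,3-6)])
  moreover have "(p + q * l) * (9/5 + l) - 9/5 * l = q * l\<^sup>2 + (p + 9/5 * q - 9/5) * l + 9/5 * p"
    by (simp add: algebra_simps power2_eq_square)
  ultimately have "(p + q * l) * (9/5 + l) \<le> 9/5 * l" by linarith
  then show ?thesis using assms by (subst pos_le_divide_eq) auto
qed

text \<open>The summand \<open>5/18 = (20/9) / 8\<close> is the largest smoothing bonus in
  \<open>potential\<close>, reached at zero information. The fraction stays below 9/5, so for large
  \<open>l\<close> the term \<open>l / 400\<close> has to carry the logarithm.\<close>

lemma ln_le_saturating_large:
  fixes l :: real
  assumes "3 \<le> l"
  shows "11/20 + 5/18 + ln l / 4 \<le> 9/5 * l / (9/5 + l) + l / 400"
proof -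
  note ln = ln_le_affine[of l]
  consider "l \<le> 6" | "6 \<le> l" "l \<le> 16" | "16 \<le> l" "l \<le> 85" | "85 \<le> l" by linarith
  then show ?thesis
  proof cases
    case 1
    then have "(11/20 + 5/18) + (1 / (4 * (1359/500))) * l \<le> 9/5 * l / (9/5 + l) + l / 400"
      using affine_le_saturating[of "1 / (4 * (1359/500)) - 1/400" 3 l 6 "11/20 + 5/18"] assms
      by (simp add: power2_eq_square left_diff_distrib)
    then show ?thesis using ln(7) assms by simp
  next
    case 2
    then have "(11/20 + 5/18 + 1/4) + (1 / (4 * (7387/1000))) * l \<le> 9/5 * l / (9/5 + l) + l / 400"
      using affine_le_saturating[of "1 / (4 * (7387/1000)) - 1/400" 6 l 16 "11/20 + 5/18 + 1/4"]
      by (simp add: power2_eq_square left_diff_distrib)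
    then show ?thesis using ln(8) assms by simp
  next
    case 3
    then have "(11/20 + 5/18 + 3/4) + (1 / (4 * (109/2))) * l \<le> 9/5 * l / (9/5 + l) + l / 400"
      using affine_le_saturating[of "1 / (4 * (109/2)) - 1/400" 16 l 85 "11/20 + 5/18 + 3/4"]
      by (simp add: power2_eq_square left_diff_distrib)
    then show ?thesis using ln(9) assms by simp
  next
    case 4
    \<comment> \<open>A quarter of the tangent at \<open>exp 5\<close> has slope
      \<open>1 / (4 * 148) < 1/400\<close>. The remaining linear coefficient is negative, so
      \<open>affine_le_saturating\<close> does not apply, and \<open>85 * l \<le> l\<^sup>2\<close>
      settles the quadratic directly.\<close>
    have expand: "(c + k * l) * (9/5 + l) = 9/5 * c + (c + 9/5 * k) * l + k * l\<^sup>2" for c k :: real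
      by (simp add: algebra_simps power2_eq_square)
    have "85 * l \<le> l\<^sup>2" using 4 by (simp add: power2_eq_square)
    then have "(11/20 + 5/18 + 1 + (1 / (4 * 148) - 1/400) * l) * (9/5 + l) \<le> 9/5 * l"
      unfolding expand using 4 by simp
    then have "11/20 + 5/18 + 1 + (1 / (4 * 148) - 1/400) * l \<le> 9/5 * l / (9/5 + l)"
      using 4 by (subst pos_le_divide_eq) auto
    then show ?thesis using ln(10) assms by (simp add: left_diff_distrib)
  qed
qed

lemma ln_le_saturating:
  fixes l :: real
  assumes "0 < l"
  shows "11/20 + ln l / 4 \<le> 9/5 * l / (9/5 + l) + l / 400"
proof -
  note ln = ln_le_affine[OF assms]
  consider "l \<le> (27/100)" | "(27/100) \<le> l" "l \<le> (1/2)" | "(1/2) \<le> l" "l \<le> (3/2)" | "(3/2) \<le> l" "l \<le> 3" | "3 \<le> l"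
    by linarith
  then show ?thesis
  proof cases
    case 1
    then have "(11/20 - 5/8) + ((22411/5000)/4) * l \<le> 9/5 * l / (9/5 + l)"
      by (intro affine_le_saturating[of _ 0 _ "(27/100)"]) (use assms in \<open>simp_all add: power2_eq_square\<close>)
    then show ?thesis using ln(2) assms by simp
  next
    case 2
    then have "(11/20 - 1/2) + ((27183/10000)/4) * l \<le> 9/5 * l / (9/5 + l)"
      by (intro affine_le_saturating[of _ "(27/100)" _ "(1/2)"]) (simp_all add: power2_eq_square)
    then show ?thesis using ln(3) assms by simp
  next
    case 3
    then have "(11/20 - 3/8) + ((2061/1250)/4) * l \<le> 9/5 * l / (9/5 + l)"
      by (intro affine_le_saturating[of _ "(1/2)" _ "(3/2)"]) (simp_all add: power2_eq_square)
    then show ?thesis using ln(4) assms by simp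
  next
    case 4
    then have "11/20 + (1/(4 * (1359/500))) * l \<le> 9/5 * l / (9/5 + l)"
      by (intro affine_le_saturating[of _ "(3/2)" _ 3]) (simp_all add: power2_eq_square)
    then show ?thesis using ln(7) assms by simp
  next
    case 5
    then show ?thesis using ln_le_saturating_large[OF 5] by simp
  qed
qed

text \<open>Serves \<open>x < 20/9\<close>, where the risk contains \<open>exp (- x) / D\<close>
  with \<open>D = 9/5 + l\<close> and the potential contains \<open>- x / 8\<close>. The minimum of
  \<open>exp (- x) / D + x / 8\<close> over \<open>x\<close> is \<open>1/8 - ln (D / 8) / 8\<close>;
  this is the inequality left after that minimization.\<close>

lemma ln_ln_le_saturating:
  fixes l :: real
  assumes "(8/25) \<le> l" "l \<le> 3"
  shows "11/20 + 5/18 - 1/8 + ln l / 4 + ln ((9/5 + l) / 8) / 8 \<le> 9/5 * l / (9/5 + l)"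
proof -
  have pos: "0 < l" "0 < (9/5 + l) / 8" using assms by auto
  note ln = ln_le_affine[OF pos(1)] and ln' = ln_le_affine[OF pos(2)]
  define R where "R = 9/5 * l / (9/5 + l)"
  consider "l \<le> (1/2)" | "(1/2) \<le> l" "l \<le> (6/5)" | "(6/5) \<le> l" by linarith
  then show ?thesis
  proof cases
    case 1
    then have "(11/20 + 5/18 - 1/8 - 1/2 - 9/32 + (8727/2500)/64 * (9/5)) + ((27183/10000)/4 + (8727/2500)/64) * l
        \<le> 9/5 * l / (9/5 + l)"
      by (intro affine_le_saturating[of _ "(8/25)" _ "(1/2)"]) (use assms in \<open>simp_all add: power2_eq_square\<close>)
    then show ?thesis using ln(3) ln'(5) unfolding R_def[symmetric] by argo
  next
    case 2
    then have "(11/20 + 5/18 - 1/8 - 3/8 - 1/4 + (27183/10000)/64 * (9/5)) + ((2061/1250)/4 + (27183/10000)/64) * l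
        \<le> 9/5 * l / (9/5 + l)"
      by (intro affine_le_saturating[of _ "(1/2)" _ "(6/5)"]) (simp_all add: power2_eq_square)
    then show ?thesis using ln(4) ln'(3) unfolding R_def[symmetric] by argo
  next
    case 3
    then have "(11/20 + 5/18 - 1/8 - 1/8 - 1/4 + (27183/10000)/64 * (9/5)) + (1/(4 * (8243/5000)) + (27183/10000)/64) * l
        \<le> 9/5 * l / (9/5 + l)"
      by (intro affine_le_saturating[of _ "(6/5)" _ 3]) (use assms in \<open>simp_all add: power2_eq_square\<close>)
    then show ?thesis using ln(6) ln'(3) unfolding R_def[symmetric] by argo
  qed
qed

text \<open>
  Half the sum and half the difference of the likelihood ratios \<open>exp (S - x / 2)\<close> and
  \<open>exp (- S - x / 2)\<close> of the two perturbations in one direction.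
\<close>

definition mix :: "real \<Rightarrow> real \<Rightarrow> real" where
  "mix x S = exp (- x / 2) * cosh S"

definition dmix :: "real \<Rightarrow> real \<Rightarrow> real" where
  "dmix x S = exp (- x / 2) * sinh S"

text \<open>
  The additional information \<open>20/9\<close> is chosen such that the smoothed \<open>ln cosh\<close> has expectation at
  least \<open>(sqrt (1 + 2 * 20/9) - 1) / 2 = 2/3\<close>. The potential plus \<open>x / 8\<close> then has expectation at
  least \<open>11/20 + 2/3 / 4 = 43/60\<close>.
\<close>

definition potential :: "real \<Rightarrow> real \<Rightarrow> real" where
  "potential x S = 11/20 + (ln (cosh S) + max 0 (20/9 - x) / 2 - x / 2) / 4"

lemma mix_pos: "0 < mix x S"
  by (simp add: mix_def)

lemma ln_mix: "ln (mix x S) = ln (cosh S) - x / 2"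
  by (simp add: mix_def ln_mult)

lemma exp_le_mix: "exp (- x / 2) \<le> mix x S"
  using cosh_real_ge_1[of S] by (simp add: mix_def)

lemma dmix_sq: "(dmix x S)\<^sup>2 = (mix x S)\<^sup>2 - (exp (- x / 2))\<^sup>2"
  by (simp add: mix_def dmix_def power_mult_distrib sinh_square_eq right_diff_distrib)

lemma abs_dmix_le: "\<bar>dmix x S\<bar> \<le> mix x S"
  using dmix_sq[of x S] mix_pos[of x S] abs_le_square_iff[of "dmix x S" "mix x S"] by simp

text \<open>With \<open>l\<close> and \<open>m\<close> for \<open>mix x S\<close> and
  \<open>dmix x S\<close>, the fraction is the minimum of
  \<open>(9/5 + l) * \<beta>\<^sup>2 - 2 * \<beta> * m + l\<close> over \<open>\<beta>\<close>, by
  \<open>dmix_sq\<close>.\<close>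

lemma potential_le_posterior_risk:
  assumes "0 \<le> x"
  shows "potential x S \<le> (9/5 * mix x S + (exp (- x / 2))\<^sup>2) / (9/5 + mix x S) + mix x S / 400"
proof -
  define l where "l = mix x S"
  define e where "e = exp (- x / 2)"
  have l: "0 < l" "e \<le> l" "ln (cosh S) - x / 2 = ln l"
    using mix_pos exp_le_mix by (auto simp: l_def e_def ln_mix)
  have e: "0 < e" "e \<le> 1" "ln e = - x / 2" using assms by (auto simp: e_def)
  have potential: "potential x S = 11/20 + ln l / 4 + max 0 (20/9 - x) / 8"
    using l(3) by (simp add: potential_def)
  have split: "(9/5 * l + e\<^sup>2) / (9/5 + l) = 9/5 * l / (9/5 + l) + e\<^sup>2 / (9/5 + l)"
    by (simp add: add_divide_distrib)
  have e2: "0 \<le> e\<^sup>2 / (9/5 + l)" using l(1) by simp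
  consider "20/9 \<le> x" | "x < 20/9" "3 \<le> l" | "x < 20/9" "l < 3" by linarith
  then have "potential x S \<le> (9/5 * l + e\<^sup>2) / (9/5 + l) + l / 400"
  proof cases
    case 1
    then show ?thesis using ln_le_saturating[OF l(1)] potential split e2 by simp
  next
    case 2
    then have "potential x S \<le> 11/20 + 5/18 + ln l / 4" using potential assms by simp
    then show ?thesis using ln_le_saturating_large[OF 2(2)] split e2 by simp
  next
    case 3
    \<comment> \<open>\<open>v\<close> is the value of \<open>e\<^sup>2 = exp (- x)\<close> that
      minimizes \<open>e\<^sup>2 / (9/5 + l) + x / 8\<close>; the bound
      \<open>ln_le_minus_one\<close> at \<open>e\<^sup>2 / v\<close> expresses this
      minimality.\<close>
    define v where "v = (9/5 + l) / 8"
    have v: "0 < v" using l(1) by (simp add: v_def)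
    have "ln (e\<^sup>2 / v) \<le> e\<^sup>2 / v - 1" using e(1) v by (intro ln_le_minus_one) simp
    then have "2 * ln e \<le> e\<^sup>2 / v - 1 + ln v"
      using e(1) v by (simp add: ln_div ln_realpow)
    moreover have "e\<^sup>2 / v = 8 * (e\<^sup>2 / (9/5 + l))" by (simp add: v_def)
    ultimately have "- x / 8 \<le> e\<^sup>2 / (9/5 + l) - 1/8 + ln v / 8"
      using e(3) by linarith
    moreover have "(8/25) \<le> l"
    proof -
      have "exp (- (10/9)) \<le> e" using 3 by (simp add: e_def)
      moreover have "(8/25) \<le> exp (- (10/9) :: real)"
      proof -
        have "exp (10/9 :: real) \<le> exp (9/8)" by simp
        also have "exp (9/8 :: real) = exp 1 * exp (1/8)" by (simp flip: exp_add)
        also have "exp (1/8 :: real) \<le> (1141/1000)" using exp_bound[of "1/8"] by (simp add: power2_eq_square)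
        then have "exp 1 * exp (1/8) \<le> (27183/10000) * ((1141/1000) :: real)"
          using exp_bounds(1) by (intro mult_mono) auto
        also have "\<dots> \<le> 1 / (8/25)" by simp
        finally show ?thesis by (simp add: exp_minus field_simps)
      qed
      ultimately show ?thesis using l(2) by linarith
    qed
    moreover have "max 0 (20/9 - x) = 20/9 - x" using 3 by simp
    moreover have "0 \<le> l / 400" using l(1) by simp
    ultimately show ?thesis
      using ln_ln_le_saturating[of l] 3 unfolding potential split v_def[symmetric] by argo
  qed
  then show ?thesis by (simp add: l_def e_def)
qed

text \<open>
  If the mixture weighs at least \<open>1/5\<close>, the right-hand side is minimized over \<open>\<beta>\<close>, and its minimum is
  the posterior risk of the preceding lemma. Otherwise \<open>B\<close> cannot be replaced
  by \<open>\<beta>\<^sup>2\<close>, but then the potential is so small that crude estimates suffice.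
\<close>

lemma potential_le_coordinate:
  assumes "0 \<le> x" "\<beta>\<^sup>2 \<le> B" "B \<le> 1" "9/5 \<le> \<kappa> + (d - 1) / 5"
  shows "potential x S + B / 5 \<le> (1 + B) * mix x S - 2 * \<beta> * dmix x S + (\<kappa> + d / 5) * \<beta>\<^sup>2 + mix x S / 400"
proof -
  define l where "l = mix x S"
  define m where "m = dmix x S"
  have l: "0 < l" using mix_pos by (simp add: l_def)
  show ?thesis
  proof (cases "1/5 \<le> l")
    case True
    define D where "D = 9/5 + l"
    have D: "0 < D" using l by (simp add: D_def)
    have "9/5 * l + (exp (- x / 2))\<^sup>2 = l * D - m\<^sup>2"
      using dmix_sq[of x S] by (simp add: D_def l_def m_def algebra_simps power2_eq_square)
    then have "(9/5 * l + (exp (- x / 2))\<^sup>2) / D = l - m\<^sup>2 / D"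
      using D by (simp add: diff_divide_distrib)
    moreover have "- (m\<^sup>2 / D) \<le> D * \<beta>\<^sup>2 - 2 * \<beta> * m"
    proof -
      have "0 \<le> (D * \<beta> - m)\<^sup>2 / D" using D by simp
      also have "\<dots> = D * \<beta>\<^sup>2 - 2 * \<beta> * m + m\<^sup>2 / D"
        using D by (simp add: field_simps power2_eq_square)
      finally show ?thesis by simp
    qed
    moreover have "0 \<le> (l - 1/5) * (B - \<beta>\<^sup>2)" using True assms by simp
    moreover have "9/5 * \<beta>\<^sup>2 \<le> (\<kappa> + (d - 1) / 5) * \<beta>\<^sup>2"
      using assms(4) by (rule mult_right_mono) simp
    moreover have "potential x S \<le> (9/5 * l + (exp (- x / 2))\<^sup>2) / D + l / 400"
      using potential_le_posterior_risk[OF assms(1), of S] by (simp add: l_def D_def)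
    moreover have "D * \<beta>\<^sup>2 = 9/5 * \<beta>\<^sup>2 + l * \<beta>\<^sup>2"
      by (simp add: D_def distrib_right)
    moreover have "(\<kappa> + (d - 1) / 5) * \<beta>\<^sup>2 = (\<kappa> + d / 5) * \<beta>\<^sup>2 - \<beta>\<^sup>2 / 5"
      "(l - 1/5) * (B - \<beta>\<^sup>2) = l * B - l * \<beta>\<^sup>2 - B / 5 + \<beta>\<^sup>2 / 5" "(1 + B) * l = l + l * B"
      by (simp_all add: field_simps)
    ultimately show ?thesis
      unfolding l_def[symmetric] m_def[symmetric] by linarith
  next
    case False
    \<comment> \<open>A mixture below 1/5 forces \<open>x > 20/9\<close>. The smoothing bonus is
      then zero, and the tangent of \<open>ln\<close> at \<open>exp (- 2)\<close> bounds the
      potential.\<close>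
    have "exp (- x / 2) < 1/5" using exp_le_mix[of x S] False by (simp add: l_def)
    moreover have "1/5 \<le> exp (- (10/9) :: real)"
    proof -
      have "exp (10/9 :: real) \<le> exp (3/2)" by simp
      then have "exp (10/9 :: real) \<le> 5" using exp_bounds(6) by linarith
      then show ?thesis by (simp add: exp_minus field_simps)
    qed
    ultimately have "exp (- x / 2) < exp (- (10/9))" by linarith
    then have "20/9 < x" by simp
    then have "potential x S = 11/20 + ln l / 4"
      using ln_mix[of x S] by (simp add: potential_def l_def)
    moreover have "ln l \<le> (18473/2500) * l - 3" by (rule ln_le_affine(1)[OF l])
    moreover have "0 \<le> (1/5 - l) * (1 - B)" using False assms by simp
    moreover have "(1/5 - l) * (1 - B) = 1/5 - B / 5 - l + l * B" "(1 + B) * l = l + l * B"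
      by (simp_all add: field_simps)
    moreover have "l\<^sup>2 \<le> l * (1/5)" using False l by (simp add: power2_eq_square)
    moreover have "- (m\<^sup>2 / 2) \<le> 2 * \<beta>\<^sup>2 - 2 * \<beta> * m"
      using zero_le_power2[of "2 * \<beta> - m"] by (simp add: power2_eq_square algebra_simps)
    moreover have "m\<^sup>2 \<le> l\<^sup>2" using dmix_sq[of x S] by (simp add: l_def m_def)
    moreover have "2 * \<beta>\<^sup>2 \<le> (\<kappa> + d / 5) * \<beta>\<^sup>2"
    proof (rule mult_right_mono)
      show "2 \<le> \<kappa> + d / 5" using assms(4) by argo
    qed simp
    ultimately show ?thesis using l unfolding l_def[symmetric] m_def[symmetric] by argo
  qed
qed

text \<open>
  The term \<open>B / 5\<close> of the preceding lemma is spread over the coordinates, so that a part of the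
  quadratic cost of a coordinate is paid by the others. The case \<open>B > 1\<close> follows by rescaling \<open>\<beta>\<close> to
  the unit sphere.
\<close>

lemma potential_sum_le:
  fixes x S \<beta> :: "'i \<Rightarrow> real"
  assumes "finite I" "\<And>i. i \<in> I \<Longrightarrow> 0 \<le> x i" "0 \<le> \<kappa>" "9/5 \<le> \<kappa> + (real (card I) - 1) / 5"
  defines "B \<equiv> \<Sum>i\<in>I. (\<beta> i)\<^sup>2"
  shows "(\<Sum>i\<in>I. potential (x i) (S i))
    \<le> \<kappa> * B + (\<Sum>i\<in>I. (1 + B) * mix (x i) (S i) - 2 * \<beta> i * dmix (x i) (S i) + mix (x i) (S i) / 400)"
proof -
  have main: "(\<Sum>i\<in>I. potential (x i) (S i))
      \<le> \<kappa> * B + (\<Sum>i\<in>I. (1 + B) * mix (x i) (S i) - 2 * \<gamma> i * dmix (x i) (S i) + mix (x i) (S i) / 400)"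
    if B: "B = (\<Sum>i\<in>I. (\<gamma> i)\<^sup>2)" "B \<le> 1" for \<gamma> B
  proof -
    have "(\<Sum>i\<in>I. potential (x i) (S i) + B / 5) \<le> (\<Sum>i\<in>I. (1 + B) * mix (x i) (S i) - 2 * \<gamma> i * dmix (x i) (S i)
        + (\<kappa> + card I / 5) * (\<gamma> i)\<^sup>2 + mix (x i) (S i) / 400)"
    proof (rule sum_mono)
      fix i assume i: "i \<in> I"
      have "(\<gamma> i)\<^sup>2 \<le> B" unfolding B(1) using i assms(1) by (intro member_le_sum) auto
      then show "potential (x i) (S i) + B / 5 \<le> (1 + B) * mix (x i) (S i) - 2 * \<gamma> i * dmix (x i) (S i)
          + (\<kappa> + card I / 5) * (\<gamma> i)\<^sup>2 + mix (x i) (S i) / 400"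
        using i assms B by (intro potential_le_coordinate) auto
    qed
    also have "\<dots> = (\<kappa> + card I / 5) * B
        + (\<Sum>i\<in>I. (1 + B) * mix (x i) (S i) - 2 * \<gamma> i * dmix (x i) (S i) + mix (x i) (S i) / 400)"
    proof -
      have "(\<Sum>i\<in>I. f i + K * (\<gamma> i)\<^sup>2 + g i) = K * (\<Sum>i\<in>I. (\<gamma> i)\<^sup>2) + (\<Sum>i\<in>I. f i + g i)"
        for f g and K :: real
        by (simp add: sum.distrib sum_distrib_left)
      from this[where f = "\<lambda>i. (1 + B) * mix (x i) (S i) - 2 * \<gamma> i * dmix (x i) (S i)"
          and g = "\<lambda>i. mix (x i) (S i) / 400"]
      show ?thesis unfolding B(1)[symmetric] .
    qed
    finally show ?thesis by (simp add: sum.distrib algebra_simps)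
  qed
  show ?thesis
  proof (cases "B \<le> 1")
    case True
    then show ?thesis using main[of B \<beta>] by (simp add: B_def)
  next
    case False
    define r where "r = sqrt B"
    have r: "1 < r" "r\<^sup>2 = B" using False by (auto simp: r_def)
    define \<gamma> where "\<gamma> i = \<beta> i / r" for i
    have "(\<Sum>i\<in>I. (\<gamma> i)\<^sup>2) = 1"
      using r False by (simp add: \<gamma>_def power_divide B_def[symmetric] flip: sum_divide_distrib)
    then have g1: "\<bar>\<gamma> i\<bar> \<le> 1" if "i \<in> I" for i
      using member_le_sum[of i I "\<lambda>i. (\<gamma> i)\<^sup>2"] assms(1) that by (simp add: abs_square_le_1)
    have "(\<Sum>i\<in>I. potential (x i) (S i))
      \<le> \<kappa> * 1 + (\<Sum>i\<in>I. (1 + 1) * mix (x i) (S i) - 2 * \<gamma> i * dmix (x i) (S i) + mix (x i) (S i) / 400)"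
      using \<open>(\<Sum>i\<in>I. (\<gamma> i)\<^sup>2) = 1\<close> by (intro main) auto
    also have "\<dots> \<le> \<kappa> * B + (\<Sum>i\<in>I. (1 + B) * mix (x i) (S i) - 2 * \<beta> i * dmix (x i) (S i) + mix (x i) (S i) / 400)"
    proof (rule add_mono)
      show "\<kappa> * 1 \<le> \<kappa> * B" using assms(3) False by (intro mult_left_mono) auto
    next
      show "(\<Sum>i\<in>I. (1 + 1) * mix (x i) (S i) - 2 * \<gamma> i * dmix (x i) (S i) + mix (x i) (S i) / 400)
        \<le> (\<Sum>i\<in>I. (1 + B) * mix (x i) (S i) - 2 * \<beta> i * dmix (x i) (S i) + mix (x i) (S i) / 400)"
      proof (rule sum_mono)
        fix i assume i: "i \<in> I"
        have "\<gamma> i * dmix (x i) (S i) \<le> mix (x i) (S i)"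
        proof -
          have "\<bar>\<gamma> i * dmix (x i) (S i)\<bar> \<le> 1 * mix (x i) (S i)"
            unfolding abs_mult using g1[OF i] abs_dmix_le mix_pos by (intro mult_mono) (auto simp: less_imp_le)
          then show ?thesis by simp
        qed
        \<comment> \<open>This product is the growth of the summand when \<open>\<gamma> i\<close>
          is scaled to \<open>r * \<gamma> i\<close> and the squared norm grows from 1 to
          \<open>r\<^sup>2\<close>.\<close>
        then have "0 \<le> (r - 1) * (2 * (mix (x i) (S i) - \<gamma> i * dmix (x i) (S i)) + (r - 1) * mix (x i) (S i))"
          using r(1) mix_pos[of "x i" "S i"] by (intro mult_nonneg_nonneg add_nonneg_nonneg) auto
        moreover have "\<beta> i = r * \<gamma> i" using r(1) by (simp add: \<gamma>_def)
        ultimately show "(1 + 1) * mix (x i) (S i) - 2 * \<gamma> i * dmix (x i) (S i) + mix (x i) (S i) / 400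
            \<le> (1 + B) * mix (x i) (S i) - 2 * \<beta> i * dmix (x i) (S i) + mix (x i) (S i) / 400"
          unfolding r(2)[symmetric] by (simp add: algebra_simps power2_eq_square)
      qed
    qed
    finally show ?thesis .
  qed
qed

subsection \<open>Change of measure\<close>

locale learner =
  fixes Q :: "'u measure" and \<pi> :: "nat \<Rightarrow> 'u \<times> (nat \<Rightarrow> real) \<Rightarrow> 'a::euclidean_space"
  assumes alg: "learning_algorithm Q \<pi>"
begin

abbreviation M :: "nat \<Rightarrow> ('u \<times> (nat \<Rightarrow> real)) measure" where
  "M \<equiv> interaction_space Q gauss"

abbreviation obs :: "'a \<Rightarrow> 'u \<times> (nat \<Rightarrow> real) \<Rightarrow> nat \<Rightarrow> nat \<Rightarrow> real" where
  "obs \<theta> \<omega> \<equiv> observations \<pi> \<theta> (fst \<omega>) (snd \<omega>)"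

abbreviation act :: "'a \<Rightarrow> 'u \<times> (nat \<Rightarrow> real) \<Rightarrow> nat \<Rightarrow> 'a" where
  "act \<theta> \<omega> \<equiv> action \<pi> \<theta> (fst \<omega>) (snd \<omega>)"

lemma prob_space_Q: "prob_space Q"
  using alg by (simp add: learning_algorithm_def)

lemma prob_space_M: "prob_space (M t)"
proof -
  interpret Q: prob_space Q by (rule prob_space_Q)
  interpret N: prob_space gauss by (rule prob_space_gauss)
  interpret P: prob_space "\<Pi>\<^sub>M i\<in>{..<t}. gauss" by (intro prob_space_PiM N.prob_space_axioms)
  interpret I: pair_prob_space Q "\<Pi>\<^sub>M i\<in>{..<t}. gauss" ..
  show ?thesis unfolding interaction_space_def by (rule I.prob_space_axioms)
qed

lemma obs_upd: "t \<le> s \<Longrightarrow> observations \<pi> \<theta> u (\<xi>(s := z)) t = observations \<pi> \<theta> u \<xi> t"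
  by (induction t) auto

lemma act_upd: "t \<le> s \<Longrightarrow> action \<pi> \<theta> u (\<xi>(s := z)) t = action \<pi> \<theta> u \<xi> t"
  by (simp add: action_def obs_upd)

lemma measurable_noise: "s < t \<Longrightarrow> (\<lambda>\<omega>. snd \<omega> s) \<in> borel_measurable (M t)"
proof -
  assume "s < t"
  then have "s \<in> {..<t}" by simp
  then have "(\<lambda>\<omega>. snd \<omega> s) \<in> M t \<rightarrow>\<^sub>M gauss"
    unfolding interaction_space_def by measurable
  then show ?thesis using measurable_cong_sets[OF refl sets_gauss] by blast
qed

lemma measurable_act: "s \<le> t \<Longrightarrow> (\<lambda>\<omega>. act \<theta> \<omega> s) \<in> borel_measurable (M t)"
  by (rule measurable_action[OF alg sets_gauss])

lemma measurable_history:
  "s \<le> t \<Longrightarrow> (\<lambda>\<omega>. (fst \<omega>, obs \<theta> \<omega> s)) \<in> M t \<rightarrow>\<^sub>M Q \<Otimes>\<^sub>M (\<Pi>\<^sub>M i\<in>{..<s}. (borel :: real measure))"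
  using measurable_observations[OF alg sets_gauss, of s t \<theta>]
  by (intro measurable_Pair) (auto simp: interaction_space_def)

lemma history_in_space:
  "\<omega> \<in> space (M t) \<Longrightarrow> (fst \<omega>, obs \<theta> \<omega> s) \<in> space (Q \<Otimes>\<^sub>M (\<Pi>\<^sub>M i\<in>{..<s}. (borel :: real measure)))"
  using observations_in_space[of \<pi> \<theta> "fst \<omega>" "snd \<omega>" s]
  by (auto simp: interaction_space_def space_pair_measure)

lemma measurable_extend:
  "(\<lambda>(\<omega>, z). (fst \<omega>, (snd \<omega>)(t := z))) \<in> M t \<Otimes>\<^sub>M gauss \<rightarrow>\<^sub>M M (Suc t)"
  unfolding interaction_space_def lessThan_Suc
  by (auto simp: case_prod_beta intro!: measurable_Pair measurable_fun_upd[where J = "{..<t}"])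
     measurable

text \<open>Fubini isolates the noise of the last round as an inner integral given the past. The
  inductions over rounds rest on this.\<close>

lemma nn_integral_M_Suc:
  assumes [measurable]: "f \<in> borel_measurable (M (Suc t))"
  shows "(\<integral>\<^sup>+\<omega>. f \<omega> \<partial>M (Suc t)) = (\<integral>\<^sup>+\<omega>. (\<integral>\<^sup>+z. f (fst \<omega>, (snd \<omega>)(t := z)) \<partial>gauss) \<partial>M t)"
proof -
  interpret Q: prob_space Q by (rule prob_space_Q)
  interpret N: prob_space gauss by (rule prob_space_gauss)
  interpret PS: product_sigma_finite "\<lambda>_::nat. gauss" ..
  have sf: "sigma_finite_measure (\<Pi>\<^sub>M i\<in>{..<t}. gauss)" for t
    by (intro prob_space_imp_sigma_finite prob_space_PiM N.prob_space_axioms)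
  have [measurable]: "f \<in> borel_measurable (Q \<Otimes>\<^sub>M (\<Pi>\<^sub>M i\<in>insert t {..<t}. gauss))"
    using assms by (simp add: interaction_space_def lessThan_Suc)
  have m: "(\<lambda>\<omega>. \<integral>\<^sup>+z. f (fst \<omega>, (snd \<omega>)(t := z)) \<partial>gauss) \<in> borel_measurable (Q \<Otimes>\<^sub>M (\<Pi>\<^sub>M i\<in>{..<t}. gauss))"
  proof (rule N.borel_measurable_nn_integral)
    have "(\<lambda>p. f ((\<lambda>(\<omega>, z). (fst \<omega>, (snd \<omega>)(t := z))) p)) \<in> borel_measurable (M t \<Otimes>\<^sub>M gauss)"
      using measurable_compose[OF measurable_extend assms] .
    then show "(\<lambda>(\<omega>, z). f (fst \<omega>, (snd \<omega>)(t := z)))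
        \<in> borel_measurable ((Q \<Otimes>\<^sub>M (\<Pi>\<^sub>M i\<in>{..<t}. gauss)) \<Otimes>\<^sub>M gauss)"
      by (simp add: interaction_space_def case_prod_beta)
  qed
  have "(\<integral>\<^sup>+\<omega>. f \<omega> \<partial>M (Suc t)) = (\<integral>\<^sup>+u. (\<integral>\<^sup>+\<xi>. f (u, \<xi>) \<partial>(\<Pi>\<^sub>M i\<in>insert t {..<t}. gauss)) \<partial>Q)"
    unfolding interaction_space_def lessThan_Suc
    by (rule sigma_finite_measure.nn_integral_fst[symmetric]) (use sf[of "Suc t"] in \<open>auto simp: lessThan_Suc\<close>)
  also have "\<dots> = (\<integral>\<^sup>+u. (\<integral>\<^sup>+\<xi>. (\<integral>\<^sup>+z. f (u, \<xi>(t := z)) \<partial>gauss) \<partial>(\<Pi>\<^sub>M i\<in>{..<t}. gauss)) \<partial>Q)"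
    by (intro nn_integral_cong PS.product_nn_integral_insert) auto
  also have "\<dots> = (\<integral>\<^sup>+\<omega>. (\<integral>\<^sup>+z. f (fst \<omega>, (snd \<omega>)(t := z)) \<partial>gauss) \<partial>M t)"
    unfolding interaction_space_def
    using sigma_finite_measure.nn_integral_fst[OF sf m] by simp
  finally show ?thesis .
qed

text \<open>The last assumption says that \<open>f\<close> ignores the noise from round
  \<open>t\<close> on, so each additional round integrates to a factor 1.\<close>

lemma nn_integral_M_adapted:
  assumes "t \<le> T"
    and "\<And>T. t \<le> T \<Longrightarrow> f \<in> borel_measurable (M T)"
    and "\<And>u \<xi> s z. t \<le> s \<Longrightarrow> f (u, \<xi>(s := z)) = f (u, \<xi>)"
  shows "(\<integral>\<^sup>+\<omega>. f \<omega> \<partial>M T) = (\<integral>\<^sup>+\<omega>. f \<omega> \<partial>M t)"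
  using assms(1)
proof (induction T rule: dec_induct)
  case (step T)
  then have "(\<integral>\<^sup>+\<omega>. f \<omega> \<partial>M (Suc T)) = (\<integral>\<^sup>+\<omega>. (\<integral>\<^sup>+z. f (fst \<omega>, (snd \<omega>)(T := z)) \<partial>gauss) \<partial>M T)"
    using assms(2)[of "Suc T"] by (intro nn_integral_M_Suc) simp
  also have "\<dots> = (\<integral>\<^sup>+\<omega>. f \<omega> \<partial>M T)"
    using step assms(3) by simp
  finally show ?case using step by simp
qed simp

section \<open>Information, score and likelihood ratio\<close>

definition info :: "'a \<Rightarrow> 'a \<Rightarrow> 'u \<times> (nat \<Rightarrow> real) \<Rightarrow> nat \<Rightarrow> real" where
  "info \<theta> v \<omega> t = (\<Sum>s<t. (act \<theta> \<omega> s \<bullet> v)\<^sup>2)"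

definition score :: "'a \<Rightarrow> 'a \<Rightarrow> 'u \<times> (nat \<Rightarrow> real) \<Rightarrow> nat \<Rightarrow> real" where
  "score \<theta> v \<omega> t = (\<Sum>s<t. (act \<theta> \<omega> s \<bullet> v) * snd \<omega> s)"

text \<open>The density of the observations in \<open>\<theta> + v\<close> relative to those in
  \<open>\<theta>\<close>. In the instance \<open>\<theta>\<close> the residual of an observation is
  the noise itself, so one round contributes \<open>exp (m * z - m\<^sup>2 / 2)\<close> with noise
  \<open>z\<close> and mean shift \<open>m\<close>.\<close>

definition lr :: "'a \<Rightarrow> 'a \<Rightarrow> 'u \<times> (nat \<Rightarrow> real) \<Rightarrow> nat \<Rightarrow> real" where
  "lr \<theta> v \<omega> t = exp (score \<theta> v \<omega> t - info \<theta> v \<omega> t / 2)"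

lemma measurable_info: "t \<le> T \<Longrightarrow> (\<lambda>\<omega>. info \<theta> v \<omega> t) \<in> borel_measurable (M T)"
  unfolding info_def by (intro borel_measurable_sum borel_measurable_power borel_measurable_inner measurable_act) auto

lemma measurable_score: "t \<le> T \<Longrightarrow> (\<lambda>\<omega>. score \<theta> v \<omega> t) \<in> borel_measurable (M T)"
  unfolding score_def
  by (intro borel_measurable_sum borel_measurable_times borel_measurable_inner measurable_act measurable_noise) auto

lemma measurable_lr: "t \<le> T \<Longrightarrow> (\<lambda>\<omega>. lr \<theta> v \<omega> t) \<in> borel_measurable (M T)"
  unfolding lr_def using measurable_info[of t T] measurable_score[of t T] by measurable

lemma info_upd: "t \<le> s \<Longrightarrow> info \<theta> v (u, \<xi>(s := z)) t = info \<theta> v (u, \<xi>) t"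
  by (simp add: info_def act_upd)

lemma score_upd: "t \<le> s \<Longrightarrow> score \<theta> v (u, \<xi>(s := z)) t = score \<theta> v (u, \<xi>) t"
  by (simp add: score_def act_upd)

text \<open>A discrete Girsanov formula. The noise law is the same on both sides; the instance
  enters only through the history it generates. The induction applies
  \<open>nn_integral_gauss_shift\<close> to the last observation.\<close>

lemma change_of_measure:
  assumes "g \<in> borel_measurable (Q \<Otimes>\<^sub>M (\<Pi>\<^sub>M i\<in>{..<t}. (borel :: real measure)))"
  shows "(\<integral>\<^sup>+\<omega>. g (fst \<omega>, obs (\<theta> + v) \<omega> t) \<partial>M t)
    = (\<integral>\<^sup>+\<omega>. g (fst \<omega>, obs \<theta> \<omega> t) * ennreal (lr \<theta> v \<omega> t) \<partial>M t)"
  using assms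
proof (induction t arbitrary: g)
  case 0
  then show ?case by (simp add: lr_def info_def score_def)
next
  case (Suc t)
  let ?H = "Q \<Otimes>\<^sub>M (\<Pi>\<^sub>M i\<in>{..<t}. (borel :: real measure))"
  note g = Suc.prems
  \<comment> \<open>\<open>k w p\<close> averages \<open>g\<close> over the last observation in the
    instance \<open>w\<close>, given the history \<open>p\<close>. As a function of the shorter
    history it can replace \<open>g\<close> in the induction hypothesis.\<close>
  define k where "k w p = (\<integral>\<^sup>+z. g (fst p, (snd p)(t := \<pi> t p \<bullet> w + z)) \<partial>gauss)" for w p
  have pi [measurable]: "\<pi> t \<in> borel_measurable ?H"
    using alg by (simp add: learning_algorithm_def)
  have ext: "(\<lambda>(p, z). (fst p, (snd p)(t := \<pi> t p \<bullet> w + z))) \<in> ?H \<Otimes>\<^sub>M borel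
      \<rightarrow>\<^sub>M Q \<Otimes>\<^sub>M (\<Pi>\<^sub>M i\<in>{..<Suc t}. (borel :: real measure))" for w
    unfolding lessThan_Suc case_prod_beta
    by (intro measurable_Pair measurable_fun_upd[where J = "{..<t}"]) (auto, measurable)
  have gm: "(\<lambda>(p, z). g (fst p, (snd p)(t := \<pi> t p \<bullet> w + z))) \<in> borel_measurable (?H \<Otimes>\<^sub>M borel)" for w
    using measurable_compose[OF ext[of w] g] by (simp add: case_prod_beta)
  have k [measurable]: "k w \<in> borel_measurable ?H" for w
  proof -
    interpret sigma_finite_measure gauss
      using prob_space_gauss prob_space_imp_sigma_finite by blast
    have "(\<lambda>(p, z). g (fst p, (snd p)(t := \<pi> t p \<bullet> w + z))) \<in> borel_measurable (?H \<Otimes>\<^sub>M gauss)"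
      using gm[of w] by (simp cong: measurable_cong_sets sets_pair_measure_cong)
    then show ?thesis unfolding k_def by (rule borel_measurable_nn_integral)
  qed
  have hist: "(\<lambda>\<omega>. g (fst \<omega>, obs w \<omega> (Suc t))) \<in> borel_measurable (M (Suc t))" for w
    using measurable_compose[OF measurable_history[of "Suc t" "Suc t" w] g] by simp
  have "(\<integral>\<^sup>+\<omega>. g (fst \<omega>, obs (\<theta> + v) \<omega> (Suc t)) \<partial>M (Suc t))
      = (\<integral>\<^sup>+\<omega>. k (\<theta> + v) (fst \<omega>, obs (\<theta> + v) \<omega> t) \<partial>M t)"
    by (subst nn_integral_M_Suc[OF hist]) (simp add: k_def obs_upd)
  also have "\<dots> = (\<integral>\<^sup>+\<omega>. k (\<theta> + v) (fst \<omega>, obs \<theta> \<omega> t) * ennreal (lr \<theta> v \<omega> t) \<partial>M t)"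
    by (rule Suc.IH) simp
  also have "\<dots> = (\<integral>\<^sup>+\<omega>. (\<integral>\<^sup>+z. g (fst \<omega>, obs \<theta> (fst \<omega>, (snd \<omega>)(t := z)) (Suc t)) *
      ennreal (lr \<theta> v (fst \<omega>, (snd \<omega>)(t := z)) (Suc t)) \<partial>gauss) \<partial>M t)"
  proof (rule nn_integral_cong)
    fix \<omega> assume \<omega>: "\<omega> \<in> space (M t)"
    define p where "p = (fst \<omega>, obs \<theta> \<omega> t)"
    define m where "m = act \<theta> \<omega> t \<bullet> v"
    have p: "p \<in> space ?H" using history_in_space[OF \<omega>] by (simp add: p_def)
    have act: "\<pi> t p = act \<theta> \<omega> t" by (simp add: action_def p_def)
    define f where "f y = g (fst p, (snd p)(t := \<pi> t p \<bullet> \<theta> + y))" for y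
    have f [measurable]: "f \<in> borel_measurable borel"
      using measurable_compose[OF measurable_Pair1'[OF p] gm[of \<theta>]] by (simp add: f_def[abs_def])
    have "k (\<theta> + v) p = (\<integral>\<^sup>+z. f (m + z) \<partial>gauss)"
      by (simp add: k_def f_def act m_def inner_add_right add.assoc)
    also have "\<dots> = (\<integral>\<^sup>+z. f z * ennreal (exp (m * z - m\<^sup>2 / 2)) \<partial>gauss)"
      by (rule nn_integral_gauss_shift[OF f])
    finally have "k (\<theta> + v) p * ennreal (lr \<theta> v \<omega> t)
        = (\<integral>\<^sup>+z. f z * ennreal (exp (m * z - m\<^sup>2 / 2)) * ennreal (lr \<theta> v \<omega> t) \<partial>gauss)"
      by (simp add: nn_integral_multc)
    also have "\<dots> = (\<integral>\<^sup>+z. g (fst \<omega>, obs \<theta> (fst \<omega>, (snd \<omega>)(t := z)) (Suc t)) *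
        ennreal (lr \<theta> v (fst \<omega>, (snd \<omega>)(t := z)) (Suc t)) \<partial>gauss)"
    proof (rule nn_integral_cong)
      fix z
      have "lr \<theta> v (fst \<omega>, (snd \<omega>)(t := z)) (Suc t) = exp (m * z - m\<^sup>2 / 2) * lr \<theta> v \<omega> t"
        using info_upd[of t t \<theta> v "fst \<omega>" "snd \<omega>" z] score_upd[of t t \<theta> v "fst \<omega>" "snd \<omega>" z]
        by (simp add: lr_def info_def score_def m_def act_upd flip: exp_add)
           (simp add: field_simps)
      moreover have "g (fst \<omega>, obs \<theta> (fst \<omega>, (snd \<omega>)(t := z)) (Suc t)) = f z"
        by (simp add: f_def p_def obs_upd)
      ultimately show "f z * ennreal (exp (m * z - m\<^sup>2 / 2)) * ennreal (lr \<theta> v \<omega> t)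
          = g (fst \<omega>, obs \<theta> (fst \<omega>, (snd \<omega>)(t := z)) (Suc t)) *
            ennreal (lr \<theta> v (fst \<omega>, (snd \<omega>)(t := z)) (Suc t))"
        by (simp add: ennreal_mult' mult.assoc)
    qed
    finally show "k (\<theta> + v) (fst \<omega>, obs \<theta> \<omega> t) * ennreal (lr \<theta> v \<omega> t)
        = (\<integral>\<^sup>+z. g (fst \<omega>, obs \<theta> (fst \<omega>, (snd \<omega>)(t := z)) (Suc t)) *
          ennreal (lr \<theta> v (fst \<omega>, (snd \<omega>)(t := z)) (Suc t)) \<partial>gauss)"
      by (simp add: p_def)
  qed
  also have "\<dots> = (\<integral>\<^sup>+\<omega>. g (fst \<omega>, obs \<theta> \<omega> (Suc t)) * ennreal (lr \<theta> v \<omega> (Suc t)) \<partial>M (Suc t))"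
    using hist[of \<theta>] measurable_lr[of "Suc t" "Suc t" \<theta> v]
    by (subst nn_integral_M_Suc) auto
  finally show ?case .
qed

lemma nn_integral_lr: "(\<integral>\<^sup>+\<omega>. ennreal (lr \<theta> v \<omega> t) \<partial>M t) = 1"
proof -
  interpret prob_space "M t" by (rule prob_space_M)
  show ?thesis
    using change_of_measure[of "\<lambda>_. 1" t \<theta> v] emeasure_space_1 by simp
qed

text \<open>
  A round adds to the score an increment whose variance given the past is the increment of the information.
  The remaining smoothing variance drops by the same amount until it is used up, so the
  expectation is constant before that and increases afterwards.
\<close>

lemma smoothed_ln_cosh_score_le:
  assumes "0 \<le> X"
  shows "smoothed_ln_cosh 0 (sqrt X) \<le> (\<integral>\<^sup>+\<omega>. smoothed_ln_cosh (score \<theta> v \<omega> t) (sqrt (max 0 (X - info \<theta> v \<omega> t))) \<partial>M t)"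
proof (induction t)
  case 0
  interpret prob_space "M 0" by (rule prob_space_M)
  show ?case
    using emeasure_space_1 assms by (simp add: score_def info_def)
next
  case (Suc t)
  have m: "(\<lambda>\<omega>. smoothed_ln_cosh (score \<theta> v \<omega> (Suc t)) (sqrt (max 0 (X - info \<theta> v \<omega> (Suc t))))) \<in> borel_measurable (M (Suc t))"
    using measurable_info[of "Suc t" "Suc t" \<theta> v] measurable_score[of "Suc t" "Suc t" \<theta> v] by measurable
  note Suc
  also have "(\<integral>\<^sup>+\<omega>. smoothed_ln_cosh (score \<theta> v \<omega> t) (sqrt (max 0 (X - info \<theta> v \<omega> t))) \<partial>M t)
      \<le> (\<integral>\<^sup>+\<omega>. (\<integral>\<^sup>+z. smoothed_ln_cosh (score \<theta> v (fst \<omega>, (snd \<omega>)(t := z)) (Suc t))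
          (sqrt (max 0 (X - info \<theta> v (fst \<omega>, (snd \<omega>)(t := z)) (Suc t)))) \<partial>gauss) \<partial>M t)"
  proof (rule nn_integral_mono)
    fix \<omega>
    define m where "m = act \<theta> \<omega> t \<bullet> v"
    define x where "x = info \<theta> v \<omega> t"
    have "score \<theta> v (fst \<omega>, (snd \<omega>)(t := z)) (Suc t) = score \<theta> v \<omega> t + m * z" for z
      using score_upd[of t t \<theta> v "fst \<omega>" "snd \<omega>" z] by (simp add: score_def m_def act_upd)
    moreover have "info \<theta> v (fst \<omega>, (snd \<omega>)(t := z)) (Suc t) = x + m\<^sup>2" for z
      using info_upd[of t t \<theta> v "fst \<omega>" "snd \<omega>" z] by (simp add: info_def m_def x_def act_upd)
    ultimately have "(\<integral>\<^sup>+z. smoothed_ln_cosh (score \<theta> v (fst \<omega>, (snd \<omega>)(t := z)) (Suc t))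
          (sqrt (max 0 (X - info \<theta> v (fst \<omega>, (snd \<omega>)(t := z)) (Suc t)))) \<partial>gauss)
        = smoothed_ln_cosh (score \<theta> v \<omega> t) (sqrt (m\<^sup>2 + (sqrt (max 0 (X - (x + m\<^sup>2))))\<^sup>2))"
      by (simp add: smoothed_ln_cosh_conv)
    moreover have "smoothed_ln_cosh (score \<theta> v \<omega> t) (sqrt (max 0 (X - x)))
        \<le> smoothed_ln_cosh (score \<theta> v \<omega> t) (sqrt (m\<^sup>2 + (sqrt (max 0 (X - (x + m\<^sup>2))))\<^sup>2))"
      by (intro smoothed_ln_cosh_mono) (auto simp: max_def)
    ultimately show "smoothed_ln_cosh (score \<theta> v \<omega> t) (sqrt (max 0 (X - info \<theta> v \<omega> t)))
        \<le> (\<integral>\<^sup>+z. smoothed_ln_cosh (score \<theta> v (fst \<omega>, (snd \<omega>)(t := z)) (Suc t))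
          (sqrt (max 0 (X - info \<theta> v (fst \<omega>, (snd \<omega>)(t := z)) (Suc t)))) \<partial>gauss)"
      by (simp add: x_def)
  qed
  also have "\<dots> = (\<integral>\<^sup>+\<omega>. smoothed_ln_cosh (score \<theta> v \<omega> (Suc t)) (sqrt (max 0 (X - info \<theta> v \<omega> (Suc t)))) \<partial>M (Suc t))"
    by (rule nn_integral_M_Suc[OF m, symmetric])
  finally show ?case .
qed

end

subsection \<open>Regret in the perturbed instances\<close>

definition reg :: "'a::euclidean_space \<Rightarrow> 'a \<Rightarrow> real" where
  "reg \<theta> a = norm \<theta> - \<theta> \<bullet> a"

lemma reg_nonneg: "norm a \<le> 1 \<Longrightarrow> 0 \<le> reg \<theta> a"
  using norm_cauchy_schwarz[of \<theta> a] mult_left_mono[of "norm a" 1 "norm \<theta>"] by (simp add: reg_def)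

lemma reg_le: "norm a \<le> 1 \<Longrightarrow> reg \<theta> a \<le> 2 * norm \<theta>"
  using Cauchy_Schwarz_ineq2[of \<theta> a] mult_left_mono[of "norm a" 1 "norm \<theta>"] by (simp add: reg_def)

lemma borel_measurable_reg [measurable]: "reg \<theta> \<in> borel_measurable borel"
  unfolding reg_def[abs_def] by measurable

lemma bessel_inequality:
  fixes a :: "'a::real_inner"
  assumes "finite S" "pairwise orthogonal S" "\<And>e. e \<in> S \<Longrightarrow> norm e = 1"
  shows "(\<Sum>e\<in>S. (a \<bullet> e)\<^sup>2) \<le> (norm a)\<^sup>2"
proof -
  define p where "p = (\<Sum>e\<in>S. (a \<bullet> e) *\<^sub>R e)"
  have pe: "p \<bullet> e = a \<bullet> e" if "e \<in> S" for e
  proof -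
    have "p \<bullet> e = (\<Sum>f\<in>S. if f = e then a \<bullet> e else 0)"
      unfolding p_def inner_sum_left
    proof (rule sum.cong[OF refl])
      fix f assume "f \<in> S"
      then show "(a \<bullet> f) *\<^sub>R f \<bullet> e = (if f = e then a \<bullet> e else 0)"
        using assms(2,3) that by (auto simp: pairwise_def orthogonal_def norm_eq_1)
    qed
    then show ?thesis using assms(1) that by simp
  qed
  have "p \<bullet> p = (\<Sum>e\<in>S. (a \<bullet> e)\<^sup>2)"
    by (subst (2) p_def) (simp add: inner_sum_right pe power2_eq_square)
  moreover have "a \<bullet> p = (\<Sum>e\<in>S. (a \<bullet> e)\<^sup>2)"
    unfolding p_def by (simp add: inner_sum_right power2_eq_square)
  moreover have "0 \<le> (a - p) \<bullet> (a - p)" by simp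
  ultimately show ?thesis
    by (simp add: inner_diff_left inner_diff_right inner_commute power2_norm_eq_inner)
qed

context learner
begin

text \<open>Integration over \<open>M t\<close> suffices: the action of round \<open>t\<close>
  depends on earlier noise only, so every horizon \<open>T \<ge> t\<close> gives the same value, as
  \<open>integral_reg_act\<close> shows.\<close>

definition mean_reg :: "'a \<Rightarrow> nat \<Rightarrow> real" where
  "mean_reg \<theta> t = (\<integral>\<omega>. reg \<theta> (act \<theta> \<omega> t) \<partial>M t)"

lemma norm_act: "\<omega> \<in> space (M T) \<Longrightarrow> norm (act \<theta> \<omega> t) \<le> 1"
  by (rule norm_action_le[OF alg])

lemma measurable_reg_act: "t \<le> T \<Longrightarrow> (\<lambda>\<omega>. reg \<theta> (act \<theta>' \<omega> t)) \<in> borel_measurable (M T)"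
  using measurable_act[of t T \<theta>'] by measurable

lemma integrable_reg_act: "t \<le> T \<Longrightarrow> integrable (M T) (\<lambda>\<omega>. reg \<theta> (act \<theta> \<omega> t))"
proof -
  assume "t \<le> T"
  interpret prob_space "M T" by (rule prob_space_M)
  show ?thesis
    using norm_act[of _ T \<theta> t] reg_nonneg[of "act \<theta> _ t" \<theta>] reg_le[of "act \<theta> _ t" \<theta>] \<open>t \<le> T\<close>
    by (intro integrable_const_bound[where B = "2 * norm \<theta>"] measurable_reg_act AE_I2) auto
qed

lemma mean_reg_nonneg: "0 \<le> mean_reg \<theta> t"
  unfolding mean_reg_def by (intro Bochner_Integration.integral_nonneg_AE AE_I2 reg_nonneg norm_act)

lemma nn_integral_reg_act:
  assumes "t \<le> T"
  shows "(\<integral>\<^sup>+\<omega>. ennreal (reg \<theta> (act \<theta> \<omega> t)) \<partial>M T) = ennreal (mean_reg \<theta> t)"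
proof -
  have "(\<integral>\<^sup>+\<omega>. ennreal (reg \<theta> (act \<theta> \<omega> t)) \<partial>M T) = (\<integral>\<^sup>+\<omega>. ennreal (reg \<theta> (act \<theta> \<omega> t)) \<partial>M t)"
    using measurable_reg_act[of t]
    by (intro nn_integral_M_adapted[OF assms]) (simp_all add: act_upd)
  also have "\<dots> = ennreal (mean_reg \<theta> t)"
    unfolding mean_reg_def
    by (intro nn_integral_eq_integral integrable_reg_act AE_I2 reg_nonneg norm_act) simp
  finally show ?thesis .
qed

lemma integral_reg_act: "t \<le> T \<Longrightarrow> (\<integral>\<omega>. reg \<theta> (act \<theta> \<omega> t) \<partial>M T) = mean_reg \<theta> t"
  using nn_integral_reg_act[of t T \<theta>] mean_reg_nonneg[of \<theta> t] measurable_reg_act[of t T \<theta> \<theta>]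
  by (subst integral_eq_nn_integral) (auto intro!: AE_I2 reg_nonneg norm_act)

lemma expected_regret_eq: "expected_regret Q \<pi> gauss T \<theta> = (\<Sum>t<T. mean_reg \<theta> t)"
proof -
  have best: "\<theta> \<bullet> best_action \<theta> = norm \<theta>"
    by (cases "\<theta> = 0") (simp_all add: best_action_def dot_square_norm power2_eq_square)
  have "expected_regret Q \<pi> gauss T \<theta> = (\<integral>\<omega>. (\<Sum>t<T. reg \<theta> (act \<theta> \<omega> t)) \<partial>M T)"
    unfolding expected_regret_def regret_against_def case_prod_beta
    by (simp add: inner_diff_right best reg_def)
  also have "\<dots> = (\<Sum>t<T. mean_reg \<theta> t)"
    by (subst Bochner_Integration.integral_sum) (simp_all add: integrable_reg_act integral_reg_act)
  finally show ?thesis .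
qed

text \<open>Expresses the regret of each perturbed instance through the actions played in
  \<open>\<theta>\<close>, so that all instances can be compared on one path.\<close>

lemma nn_integral_reg_lr:
  "(\<integral>\<^sup>+\<omega>. ennreal (reg (\<theta> + v) (act \<theta> \<omega> t)) * ennreal (lr \<theta> v \<omega> t) \<partial>M t) = ennreal (mean_reg (\<theta> + v) t)"
proof -
  define g where "g p = ennreal (reg (\<theta> + v) (\<pi> t p))" for p
  have [measurable]: "\<pi> t \<in> borel_measurable (Q \<Otimes>\<^sub>M (\<Pi>\<^sub>M i\<in>{..<t}. (borel :: real measure)))"
    using alg by (simp add: learning_algorithm_def)
  have "g \<in> borel_measurable (Q \<Otimes>\<^sub>M (\<Pi>\<^sub>M i\<in>{..<t}. (borel :: real measure)))"
    unfolding g_def by measurable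
  from change_of_measure[OF this, of \<theta> v] show ?thesis
    using nn_integral_reg_act[of t t "\<theta> + v"] by (simp add: g_def action_def)
qed

end

text \<open>With \<open>u = z / c\<close> this is
  \<open>1 + u / 2 - u\<^sup>2 / 8 \<le> sqrt (1 + u)\<close>. The square of the left side falls
  short of \<open>1 + u\<close> by \<open>u ^ 3 * (8 - u) / 64\<close>, whence the range
  \<open>z \<le> 8 * c\<close>.\<close>

lemma norm_perturbed_ge:
  assumes "0 < c" "0 \<le> z" "z \<le> 8 * c"
  shows "c + z / 2 * (1 - z / (4 * c)) \<le> sqrt (c\<^sup>2 + c * z)"
proof (rule real_le_rsqrt)
  define u where "u = z / c"
  have z: "z = c * u" and u: "0 \<le> u" "u \<le> 8" using assms by (auto simp: u_def field_simps)
  have "(c + z / 2 * (1 - z / (4 * c)))\<^sup>2 = c\<^sup>2 * (1 + u / 2 * (1 - u / 4))\<^sup>2"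
    using assms(1) by (simp add: z power2_eq_square field_simps)
  also have "(1 + u / 2 * (1 - u / 4))\<^sup>2 = 1 + u - u ^ 3 * (8 - u) / 64"
    by (simp add: power2_eq_square power3_eq_cube field_simps)
  also have "\<dots> \<le> 1 + u" using u by simp
  then have "c\<^sup>2 * (1 + u - u ^ 3 * (8 - u) / 64) \<le> c\<^sup>2 * (1 + u)" by (intro mult_left_mono) auto
  also have "\<dots> = c\<^sup>2 + c * z" by (simp add: z power2_eq_square algebra_simps)
  finally show "(c + z / 2 * (1 - z / (4 * c)))\<^sup>2 \<le> c\<^sup>2 + c * z" .
qed

lemma ennreal_affine:
  assumes "0 \<le> p" "0 \<le> q" "0 \<le> r" "0 \<le> s"
  shows "ennreal p * ennreal q + ennreal r = ennreal (p * q + r)"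
    and "ennreal p * (ennreal q * ennreal s) + ennreal r * ennreal s = ennreal ((p * q + r) * s)"
    and "ennreal p * (ennreal q + ennreal r * ennreal s) = ennreal (p * (q + r * s))"
  using assms by (simp_all add: ennreal_mult ennreal_plus distrib_right mult.assoc)

lemma sum_ennreal_add:
  assumes "\<And>e. 0 \<le> f e" "\<And>e. 0 \<le> g e"
  shows "(\<Sum>e\<in>E. ennreal (f e) + ennreal (g e)) = ennreal (\<Sum>e\<in>E. f e + g e)"
  using assms by (simp flip: ennreal_plus)

section \<open>The perturbation family around the hint\<close>

locale hinted_learner = learner Q \<pi>
  for Q :: "'u measure" and \<pi> :: "nat \<Rightarrow> 'u \<times> (nat \<Rightarrow> real) \<Rightarrow> 'a::euclidean_space" +
  fixes h :: 'a and E :: "'a set" and c z :: real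
  assumes norm_h: "norm h = 1"
    and E: "finite E" "h \<notin> E" "pairwise orthogonal (insert h E)" "\<And>e. e \<in> E \<Longrightarrow> norm e = 1"
    and cz: "0 < c" "0 < z" "z \<le> 8 * c"
begin

text \<open>With this size of the perturbation the optimal reward exceeds \<open>c\<close> by about
  \<open>z / 2\<close>.\<close>

definition w :: real where "w = sqrt (c * z)"

lemma w: "0 < w" "w\<^sup>2 = c * z"
  using cz by (auto simp: w_def)

lemma h_e: "e \<in> E \<Longrightarrow> h \<bullet> e = 0"
  using E(2,3) by (auto simp: pairwise_def orthogonal_def)

lemma norm_instance: "e \<in> E \<Longrightarrow> \<bar>\<sigma>\<bar> = w \<Longrightarrow> norm (c *\<^sub>R h + \<sigma> *\<^sub>R e) = sqrt (c\<^sup>2 + c * z)"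
proof -
  assume e: "e \<in> E" and \<sigma>: "\<bar>\<sigma>\<bar> = w"
  have "\<sigma>\<^sup>2 = c * z" using \<sigma> w(2) by (metis power2_abs)
  moreover have "h \<bullet> h = 1" "e \<bullet> e = 1" using norm_h E(4)[OF e] by (simp_all add: norm_eq_1)
  ultimately show ?thesis
    using h_e[OF e] inner_commute[of h e]
    by (simp add: norm_eq_sqrt_inner inner_add_left inner_add_right power2_eq_square)
qed

text \<open>The price of exploration: Bessel's inequality leaves at most
  \<open>1 - (a \<bullet> h)\<^sup>2\<close> for all directions together, and
  \<open>1 - y\<^sup>2 \<le> 2 * (1 - y)\<close>.\<close>

lemma bessel_h:
  assumes "norm a \<le> 1"
  shows "(\<Sum>e\<in>E. (a \<bullet> e)\<^sup>2) \<le> 2 * (1 - a \<bullet> h)"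
proof -
  have "(\<Sum>e\<in>insert h E. (a \<bullet> e)\<^sup>2) \<le> (norm a)\<^sup>2"
    using E norm_h by (intro bessel_inequality) auto
  also have "\<dots> \<le> 1" using assms by (simp add: abs_square_le_1)
  finally have "(\<Sum>e\<in>E. (a \<bullet> e)\<^sup>2) \<le> 1 - (a \<bullet> h)\<^sup>2" using E by simp
  also have "\<dots> \<le> 2 * (1 - a \<bullet> h)"
    using zero_le_power2[of "1 - a \<bullet> h"] by (simp add: power2_eq_square algebra_simps)
  finally show ?thesis .
qed

lemma reg_h: "reg (c *\<^sub>R h) a = c * (1 - a \<bullet> h)"
  using cz norm_h by (simp add: reg_def inner_commute algebra_simps)

text \<open>
  In this scaling the regret of \<open>a\<close> in the instance \<open>c h + \<sigma> e\<close>, where \<open>\<sigma>\<close> is \<open>w\<close> or \<open>- w\<close>, is at least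
  about \<open>z / 2\<close> times the squared distance of \<open>dev a\<close> to the unit vector of \<open>e\<close> or its negative.
\<close>

definition dev :: "'a \<Rightarrow> 'a \<Rightarrow> real" where
  "dev a e = c / w * (a \<bullet> e)"

lemma reg_h_ge:
  assumes a: "norm a \<le> 1"
  shows "z / 2 * (\<Sum>e\<in>E. (dev a e)\<^sup>2) \<le> reg (c *\<^sub>R h) a"
proof -
  have "(dev a e)\<^sup>2 = c / z * (a \<bullet> e)\<^sup>2" for e
    using cz unfolding dev_def power_mult_distrib power_divide w(2) by (simp add: power2_eq_square)
  then have "(\<Sum>e\<in>E. (dev a e)\<^sup>2) = c / z * (\<Sum>e\<in>E. (a \<bullet> e)\<^sup>2)"
    by (simp only: sum_distrib_left)
  then have "z / 2 * (\<Sum>e\<in>E. (dev a e)\<^sup>2) = c / 2 * (\<Sum>e\<in>E. (a \<bullet> e)\<^sup>2)"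
    using cz by simp
  then show ?thesis
    using mult_left_mono[OF bessel_h[OF a], of "c / 2"] cz by (simp add: reg_h)
qed

lemma reg_instance_ge:
  assumes a: "norm a \<le> 1" and e: "e \<in> E" and \<sigma>: "\<bar>\<sigma>\<bar> = w"
  shows "z / 2 * (1 - z / (4 * c) + (\<Sum>e\<in>E. (dev a e)\<^sup>2) - 2 * (\<sigma> / w) * dev a e) \<le> reg (c *\<^sub>R h + \<sigma> *\<^sub>R e) a"
proof -
  have "z * c / (w * w) = 1"
    using w cz by (simp add: power2_eq_square)
  moreover have "z / 2 * (2 * (\<sigma> / w) * dev a e) = (z * c / (w * w)) * (\<sigma> * (a \<bullet> e))"
    by (simp add: dev_def)
  ultimately have "z / 2 * (2 * (\<sigma> / w) * dev a e) = \<sigma> * (a \<bullet> e)"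
    by (simp only: mult_1)
  \<comment> \<open>An exact splitting: the gain in optimal reward, plus the regret in the null
    instance, minus the reward collected along the perturbation.\<close>
  moreover have "reg (c *\<^sub>R h + \<sigma> *\<^sub>R e) a = sqrt (c\<^sup>2 + c * z) - c + reg (c *\<^sub>R h) a - \<sigma> * (a \<bullet> e)"
    unfolding reg_h unfolding reg_def norm_instance[OF e \<sigma>]
    by (simp add: inner_add_left inner_commute algebra_simps)
  moreover have "z / 2 * (1 - z / (4 * c)) + c \<le> sqrt (c\<^sup>2 + c * z)"
    using norm_perturbed_ge[of c z] cz by linarith
  ultimately show ?thesis
    using reg_h_ge[OF a] unfolding distrib_left right_diff_distrib by linarith
qed

text \<open>Before any observation both instances see the same action, so the linear terms cancel
  and the whole gap of about \<open>z / 2\<close> is lost on average. This better constant pays for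
  the additive 1/4 in \<open>tradeoff\<close>.\<close>

lemma first_round_bound: "z / 2 * (1 - z / (4 * c)) \<le> (mean_reg (c *\<^sub>R h + w *\<^sub>R e) 0 + mean_reg (c *\<^sub>R h - w *\<^sub>R e) 0) / 2"
  if e: "e \<in> E"
proof -
  interpret prob_space "M 0" by (rule prob_space_M)
  define a\<^sub>0 where "a\<^sub>0 \<omega> = \<pi> 0 (fst \<omega>, \<lambda>_. undefined)" for \<omega> :: "'u \<times> (nat \<Rightarrow> real)"
  have a: "act \<theta> \<omega> 0 = a\<^sub>0 \<omega>" for \<theta> \<omega> by (simp add: action_def a\<^sub>0_def)
  have int: "integrable (M 0) (\<lambda>\<omega>. reg \<theta> (a\<^sub>0 \<omega>))" for \<theta>
    using integrable_reg_act[of 0 0 \<theta>] by (simp only: a)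
  have "mean_reg (c *\<^sub>R h + w *\<^sub>R e) 0 + mean_reg (c *\<^sub>R h - w *\<^sub>R e) 0
      = (\<integral>\<omega>. reg (c *\<^sub>R h + w *\<^sub>R e) (a\<^sub>0 \<omega>) + reg (c *\<^sub>R h - w *\<^sub>R e) (a\<^sub>0 \<omega>) \<partial>M 0)"
    unfolding mean_reg_def a using int by simp
  also have "\<dots> \<ge> (\<integral>\<omega>. 2 * (z / 2 * (1 - z / (4 * c))) \<partial>M 0)"
  proof (rule integral_mono)
    fix \<omega> assume "\<omega> \<in> space (M 0)"
    then have a: "norm (a\<^sub>0 \<omega>) \<le> 1" using norm_act[of \<omega> 0 _ 0] by (simp only: a)
    have "norm (c *\<^sub>R h - w *\<^sub>R e) = sqrt (c\<^sup>2 + c * z)"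
      using norm_instance[OF e, of "- w"] w by simp
    then have "reg (c *\<^sub>R h - w *\<^sub>R e) (a\<^sub>0 \<omega>) = sqrt (c\<^sup>2 + c * z) - c * (h \<bullet> a\<^sub>0 \<omega>) + w * (e \<bullet> a\<^sub>0 \<omega>)"
      by (simp add: reg_def inner_diff_left)
    moreover have "reg (c *\<^sub>R h + w *\<^sub>R e) (a\<^sub>0 \<omega>) = sqrt (c\<^sup>2 + c * z) - c * (h \<bullet> a\<^sub>0 \<omega>) - w * (e \<bullet> a\<^sub>0 \<omega>)"
      using norm_instance[OF e, of w] w by (simp add: reg_def inner_add_left)
    moreover have "reg (c *\<^sub>R h) (a\<^sub>0 \<omega>) = c - c * (h \<bullet> a\<^sub>0 \<omega>)"
      using cz norm_h by (simp add: reg_def)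
    moreover have "z / 2 * (1 - z / (4 * c)) + c \<le> sqrt (c\<^sup>2 + c * z)"
      using norm_perturbed_ge[of c z] cz by linarith
    ultimately show "2 * (z / 2 * (1 - z / (4 * c)))
        \<le> reg (c *\<^sub>R h + w *\<^sub>R e) (a\<^sub>0 \<omega>) + reg (c *\<^sub>R h - w *\<^sub>R e) (a\<^sub>0 \<omega>)"
      using reg_nonneg[OF a, of "c *\<^sub>R h"] by linarith
  qed (use int in auto)
  finally show ?thesis using prob_space by simp
qed

lemma mix_lr:
  "mix (info \<theta> v \<omega> t) (score \<theta> v \<omega> t) = (lr \<theta> v \<omega> t + lr \<theta> (- v) \<omega> t) / 2"
  "dmix (info \<theta> v \<omega> t) (score \<theta> v \<omega> t) = (lr \<theta> v \<omega> t - lr \<theta> (- v) \<omega> t) / 2"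
proof -
  have "info \<theta> (- v) \<omega> t = info \<theta> v \<omega> t" "score \<theta> (- v) \<omega> t = - score \<theta> v \<omega> t"
    by (simp_all add: info_def score_def sum_negf)
  then have "lr \<theta> v \<omega> t = exp (- info \<theta> v \<omega> t / 2) * exp (score \<theta> v \<omega> t)"
    "lr \<theta> (- v) \<omega> t = exp (- info \<theta> v \<omega> t / 2) * exp (- score \<theta> v \<omega> t)"
    by (simp_all add: lr_def flip: exp_add)
  then show "mix (info \<theta> v \<omega> t) (score \<theta> v \<omega> t) = (lr \<theta> v \<omega> t + lr \<theta> (- v) \<omega> t) / 2"
    "dmix (info \<theta> v \<omega> t) (score \<theta> v \<omega> t) = (lr \<theta> v \<omega> t - lr \<theta> (- v) \<omega> t) / 2"
    by (simp_all add: mix_def dmix_def cosh_field_def sinh_field_def distrib_left right_diff_distrib)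
qed

text \<open>By \<open>bessel_h\<close>, all directions share one information budget on each path,
  proportional to the regret in the null instance.\<close>

lemma sum_info_le:
  assumes "\<omega> \<in> space (M T)"
  shows "(\<Sum>e\<in>E. info \<theta> (w *\<^sub>R e) \<omega> t) \<le> 2 * z * (\<Sum>s<t. reg (c *\<^sub>R h) (act \<theta> \<omega> s))"
proof -
  have "(\<Sum>e\<in>E. info \<theta> (w *\<^sub>R e) \<omega> t) = (\<Sum>s<t. w\<^sup>2 * (\<Sum>e\<in>E. (act \<theta> \<omega> s \<bullet> e)\<^sup>2))"
    unfolding info_def by (subst sum.swap) (simp add: power_mult_distrib sum_distrib_left)
  also have "\<dots> \<le> (\<Sum>s<t. w\<^sup>2 * (2 * (1 - act \<theta> \<omega> s \<bullet> h)))"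
    by (intro sum_mono mult_left_mono bessel_h norm_act[OF assms]) simp
  also have "\<dots> = 2 * z * (\<Sum>s<t. reg (c *\<^sub>R h) (act \<theta> \<omega> s))"
    by (simp add: w reg_h sum_distrib_left mult_ac)
  finally show ?thesis .
qed

text \<open>The pathwise form of \<open>round_bound\<close>; integration turns the regrets weighted
  by \<open>lr\<close> into regrets of the perturbed instances. The correction \<open>1/400\<close>
  stems from \<open>potential_sum_le\<close> and \<open>z / (4 * c)\<close> from
  \<open>norm_perturbed_ge\<close>. The last term pays for the added \<open>info / 8\<close> through
  \<open>sum_info_le\<close>.\<close>

lemma pointwise_bound:
  assumes \<omega>: "\<omega> \<in> space (M t)" and \<kappa>: "0 \<le> \<kappa>" "9/5 \<le> \<kappa> + (real (card E) - 1) / 5"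
  defines "\<theta> \<equiv> c *\<^sub>R h"
  shows "z / 2 * (\<Sum>e\<in>E. potential (info \<theta> (w *\<^sub>R e) \<omega> t) (score \<theta> (w *\<^sub>R e) \<omega> t) + info \<theta> (w *\<^sub>R e) \<omega> t / 8)
    \<le> \<kappa> * reg \<theta> (act \<theta> \<omega> t)
      + (\<Sum>e\<in>E. (reg (\<theta> + w *\<^sub>R e) (act \<theta> \<omega> t) + z / 2 * (1/400 + z / (4 * c))) / 2 * lr \<theta> (w *\<^sub>R e) \<omega> t
          + (reg (\<theta> + - (w *\<^sub>R e)) (act \<theta> \<omega> t) + z / 2 * (1/400 + z / (4 * c))) / 2 * lr \<theta> (- (w *\<^sub>R e)) \<omega> t)
      + z / 2 * (z / 4) * (\<Sum>s<t. reg \<theta> (act \<theta> \<omega> s))"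
proof -
  define a where "a = act \<theta> \<omega> t"
  have a: "norm a \<le> 1" unfolding a_def by (rule norm_act[OF \<omega>])
  define \<beta> where "\<beta> = dev a"
  define B where "B = (\<Sum>e\<in>E. (\<beta> e)\<^sup>2)"
  define x where "x e = info \<theta> (w *\<^sub>R e) \<omega> t" for e
  define S where "S e = score \<theta> (w *\<^sub>R e) \<omega> t" for e
  have x: "0 \<le> x e" for e unfolding x_def info_def by (rule sum_nonneg) simp
  define f where "f e = (1 + B) * mix (x e) (S e) - 2 * \<beta> e * dmix (x e) (S e) + mix (x e) (S e) / 400" for e
  have "(\<Sum>e\<in>E. potential (x e) (S e)) \<le> \<kappa> * B + (\<Sum>e\<in>E. f e)"
    unfolding B_def f_def by (rule potential_sum_le) (use E x \<kappa> in auto)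
  then have "z / 2 * (\<Sum>e\<in>E. potential (x e) (S e)) \<le> z / 2 * (\<kappa> * B + (\<Sum>e\<in>E. f e))"
    using cz by (intro mult_left_mono) auto
  also have "\<dots> = \<kappa> * (z / 2 * B) + (\<Sum>e\<in>E. z / 2 * f e)"
    by (simp add: distrib_left sum_distrib_left sum_divide_distrib)
  finally have "z / 2 * (\<Sum>e\<in>E. potential (x e) (S e)) \<le> \<kappa> * (z / 2 * B) + (\<Sum>e\<in>E. z / 2 * f e)" .
  moreover have "\<kappa> * (z / 2 * B) \<le> \<kappa> * reg \<theta> a"
    unfolding B_def \<beta>_def \<theta>_def by (intro mult_left_mono reg_h_ge[OF a] \<kappa>(1))
  moreover have "z / 2 * f e
      \<le> (reg (\<theta> + w *\<^sub>R e) a + z / 2 * (1/400 + z / (4 * c))) / 2 * lr \<theta> (w *\<^sub>R e) \<omega> t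
          + (reg (\<theta> + - (w *\<^sub>R e)) a + z / 2 * (1/400 + z / (4 * c))) / 2 * lr \<theta> (- (w *\<^sub>R e)) \<omega> t"
    if e: "e \<in> E" for e
  proof -
    define k where "k = z / (4 * c)"
    define Lp where "Lp = lr \<theta> (w *\<^sub>R e) \<omega> t"
    define Lm where "Lm = lr \<theta> (- (w *\<^sub>R e)) \<omega> t"
    have half: "(P * p + R * r) / 2 = P / 2 * p + R / 2 * r" for P R p r :: real
      by (simp add: add_divide_distrib)
    have L: "0 \<le> Lp" "0 \<le> Lm" by (simp_all add: Lp_def Lm_def lr_def)
    have "z / 2 * (1 - k + B - 2 * \<beta> e) \<le> reg (\<theta> + w *\<^sub>R e) a"
      using reg_instance_ge(1)[OF a e, of w] w by (simp add: B_def \<beta>_def \<theta>_def k_def)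
    then have p: "z / 2 * (1 + B - 2 * \<beta> e + 1/400) * Lp \<le> (reg (\<theta> + w *\<^sub>R e) a + z / 2 * (1/400 + k)) * Lp"
      by (intro mult_right_mono[OF _ L(1)]) (simp add: algebra_simps)
    have "z / 2 * (1 - k + B + 2 * \<beta> e) \<le> reg (\<theta> + - (w *\<^sub>R e)) a"
      using reg_instance_ge(1)[OF a e, of "- w"] w by (simp add: B_def \<beta>_def \<theta>_def k_def)
    then have m: "z / 2 * (1 + B + 2 * \<beta> e + 1/400) * Lm \<le> (reg (\<theta> + - (w *\<^sub>R e)) a + z / 2 * (1/400 + k)) * Lm"
      by (intro mult_right_mono[OF _ L(2)]) (simp add: algebra_simps)
    have "z / 2 * ((1 + B) * ((Lp + Lm) / 2) - 2 * \<beta> e * ((Lp - Lm) / 2) + (Lp + Lm) / 2 / 400)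
      = (z / 2 * (1 + B - 2 * \<beta> e + 1/400) * Lp + z / 2 * (1 + B + 2 * \<beta> e + 1/400) * Lm) / 2"
      by (simp add: field_simps)
    also have "\<dots> \<le> ((reg (\<theta> + w *\<^sub>R e) a + z / 2 * (1/400 + k)) * Lp
        + (reg (\<theta> + - (w *\<^sub>R e)) a + z / 2 * (1/400 + k)) * Lm) / 2"
      using p m by (intro divide_right_mono add_mono) auto
    finally show ?thesis
      unfolding half f_def x_def S_def mix_lr Lp_def[symmetric] Lm_def[symmetric] k_def[symmetric] .
  qed
  then have "(\<Sum>e\<in>E. z / 2 * f e)
      \<le> (\<Sum>e\<in>E. (reg (\<theta> + w *\<^sub>R e) a + z / 2 * (1/400 + z / (4 * c))) / 2 * lr \<theta> (w *\<^sub>R e) \<omega> t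
          + (reg (\<theta> + - (w *\<^sub>R e)) a + z / 2 * (1/400 + z / (4 * c))) / 2 * lr \<theta> (- (w *\<^sub>R e)) \<omega> t)"
    by (rule sum_mono)
  moreover have "z / 2 * (\<Sum>e\<in>E. x e / 8) \<le> z / 2 * (z / 4) * (\<Sum>s<t. reg \<theta> (act \<theta> \<omega> s))"
    using mult_left_mono[OF sum_info_le[OF \<omega>, of \<theta> t], of "z / 16"] cz
    by (simp add: x_def \<theta>_def flip: sum_divide_distrib)
  moreover have "z / 2 * (\<Sum>e\<in>E. potential (x e) (S e) + x e / 8)
      = z / 2 * (\<Sum>e\<in>E. potential (x e) (S e)) + z / 2 * (\<Sum>e\<in>E. x e / 8)"
    by (simp only: sum.distrib distrib_left)
  ultimately show ?thesis
    unfolding x_def[symmetric] S_def[symmetric] a_def[symmetric] by linarith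
qed

lemma potential_info_nonneg: "0 \<le> potential (info \<theta> v \<omega> t) S + info \<theta> v \<omega> t / 8"
  using ln_cosh_nonneg[of S] by (simp add: potential_def field_simps)

lemma round_bound:
  assumes \<kappa>: "0 \<le> \<kappa>" "9/5 \<le> \<kappa> + (real (card E) - 1) / 5"
  defines "\<theta> \<equiv> c *\<^sub>R h"
  shows "z / 2 * (card E * (43/60)) \<le> \<kappa> * mean_reg \<theta> t
    + (\<Sum>e\<in>E. (mean_reg (\<theta> + w *\<^sub>R e) t + mean_reg (\<theta> - w *\<^sub>R e) t) / 2)
    + z / 2 * (card E * (1/400 + z / (4 * c))) + z / 2 * (z / 4) * (\<Sum>s<t. mean_reg \<theta> s)"
proof -
  define k where "k = z / 2 * (1/400 + z / (4 * c))"
  have k: "0 \<le> k" using cz by (simp add: k_def)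
  define G where "G e \<omega> = smoothed_ln_cosh (score \<theta> (w *\<^sub>R e) \<omega> t) (sqrt (max 0 (20/9 - info \<theta> (w *\<^sub>R e) \<omega> t)))" for e \<omega>
  have G_meas [measurable]: "G e \<in> borel_measurable (M t)" for e
    unfolding G_def using measurable_info[of t t \<theta>] measurable_score[of t t \<theta>] by measurable
  have reg_meas [measurable]: "(\<lambda>\<omega>. reg \<theta>' (act \<theta> \<omega> s)) \<in> borel_measurable (M t)" if "s \<le> t" for \<theta>' s
    using measurable_reg_act[OF that] .
  have lr_meas [measurable]: "(\<lambda>\<omega>. lr \<theta> v \<omega> t) \<in> borel_measurable (M t)" for v
    by (rule measurable_lr) simp
  \<comment> \<open>The mean of \<open>F e\<close> is at least \<open>z / 2 * (43/60)\<close> by the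
    smoothing argument, and Jensen's inequality places \<open>F e\<close> pointwise below
    \<open>z / 2\<close> times the potential plus an eighth of the information.\<close>
  define F where "F e \<omega> = ennreal (z / 2) * (ennreal (11/20) + ennreal (1/4) * G e \<omega>)" for e \<omega>
  \<comment> \<open>By the change of measure, \<open>H v\<close> integrates to
    \<open>(mean_reg (\<theta> + v) t + k) / 2\<close>.\<close>
  define H where "H v \<omega> = ennreal (1/2) * (ennreal (reg (\<theta> + v) (act \<theta> \<omega> t)) * ennreal (lr \<theta> v \<omega> t))
      + ennreal (k / 2) * ennreal (lr \<theta> v \<omega> t)" for v \<omega>
  have H_meas [measurable]: "H v \<in> borel_measurable (M t)" for v
    unfolding H_def using reg_meas[of t] by measurable
  have "(\<Sum>e\<in>E. ennreal (z / 2 * (43/60))) \<le> (\<Sum>e\<in>E. (\<integral>\<^sup>+\<omega>. F e \<omega> \<partial>M t))"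
  proof (rule sum_mono)
    fix e assume "e \<in> E"
    interpret prob_space "M t" by (rule prob_space_M)
    have sq: "(sqrt (20/9 :: real))\<^sup>2 = 20/9" by (rule real_sqrt_pow2) simp
    have "(7/3)\<^sup>2 = 1 + 2 * (sqrt (20/9 :: real))\<^sup>2"
      unfolding sq by (simp add: power2_eq_square)
    then have "sqrt (1 + 2 * (sqrt (20/9 :: real))\<^sup>2) = 7/3"
      by (rule real_sqrt_unique) simp
    then have "(sqrt (1 + 2 * (sqrt (20/9 :: real))\<^sup>2) - 1) / 2 = 2/3" by (simp only:) simp
    then have "ennreal (2/3) \<le> smoothed_ln_cosh 0 (sqrt (20/9))"
      using smoothed_ln_cosh_lower[of "sqrt (20/9)"] by (simp only:)
    also have "\<dots> \<le> (\<integral>\<^sup>+\<omega>. G e \<omega> \<partial>M t)"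
      unfolding G_def by (rule smoothed_ln_cosh_score_le) simp
    finally have "ennreal (2/3) \<le> (\<integral>\<^sup>+\<omega>. G e \<omega> \<partial>M t)" .
    then have "ennreal (z / 2) * (ennreal (11/20) + ennreal (1/4) * ennreal (2/3))
        \<le> ennreal (z / 2) * (ennreal (11/20) + ennreal (1/4) * (\<integral>\<^sup>+\<omega>. G e \<omega> \<partial>M t))"
      by (intro mult_left_mono add_left_mono) auto
    also have "\<dots> = (\<integral>\<^sup>+\<omega>. F e \<omega> \<partial>M t)"
      unfolding F_def using emeasure_space_1 by (simp add: nn_integral_cmult nn_integral_add)
    also have "ennreal (z / 2) * (ennreal (11/20) + ennreal (1/4) * ennreal (2/3)) = ennreal (z / 2 * (11/20 + 1/4 * (2/3)))"
      by (rule ennreal_affine(3)) (use cz in auto)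
    also have "11/20 + 1/4 * (2/3) = (43/60 :: real)" by simp
    finally show "ennreal (z / 2 * (43/60)) \<le> (\<integral>\<^sup>+\<omega>. F e \<omega> \<partial>M t)" .
  qed
  also have "\<dots> = (\<integral>\<^sup>+\<omega>. (\<Sum>e\<in>E. F e \<omega>) \<partial>M t)"
    unfolding F_def by (rule nn_integral_sum[symmetric]) measurable
  also have "\<dots> \<le> (\<integral>\<^sup>+\<omega>. ennreal \<kappa> * ennreal (reg \<theta> (act \<theta> \<omega> t))
      + (\<Sum>e\<in>E. H (w *\<^sub>R e) \<omega> + H (- (w *\<^sub>R e)) \<omega>)
      + ennreal (z / 2 * (z / 4)) * (\<Sum>s<t. ennreal (reg \<theta> (act \<theta> \<omega> s))) \<partial>M t)"
  proof (rule nn_integral_mono)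
    fix \<omega> assume \<omega>: "\<omega> \<in> space (M t)"
    note pos = reg_nonneg[OF norm_act[OF \<omega>]]
    have lr0: "0 \<le> lr \<theta> v \<omega> t" for v by (simp add: lr_def)
    have H: "H v \<omega> = ennreal ((reg (\<theta> + v) (act \<theta> \<omega> t) + k) / 2 * lr \<theta> v \<omega> t)" for v
    proof -
      have "H v \<omega> = ennreal ((1/2 * reg (\<theta> + v) (act \<theta> \<omega> t) + k / 2) * lr \<theta> v \<omega> t)"
        unfolding H_def by (rule ennreal_affine(2)) (use pos k lr0[of v] in auto)
      then show ?thesis by (simp add: add_divide_distrib)
    qed
    have F: "F e \<omega> \<le> ennreal (z / 2 * (potential (info \<theta> (w *\<^sub>R e) \<omega> t) (score \<theta> (w *\<^sub>R e) \<omega> t)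
        + info \<theta> (w *\<^sub>R e) \<omega> t / 8))" for e
    proof -
      define x where "x = info \<theta> (w *\<^sub>R e) \<omega> t"
      define S where "S = score \<theta> (w *\<^sub>R e) \<omega> t"
      have "G e \<omega> \<le> ennreal (ln (cosh S) + max 0 (20/9 - x) / 2)"
        using smoothed_ln_cosh_upper[of S "sqrt (max 0 (20/9 - x))"] by (simp add: G_def x_def S_def)
      then have "F e \<omega> \<le> ennreal (z / 2) * (ennreal (11/20) + ennreal (1/4) * ennreal (ln (cosh S) + max 0 (20/9 - x) / 2))"
        unfolding F_def by (intro mult_left_mono add_left_mono) auto
      also have "\<dots> = ennreal (z / 2 * (11/20 + 1/4 * (ln (cosh S) + max 0 (20/9 - x) / 2)))"
        by (rule ennreal_affine(3)) (use cz ln_cosh_nonneg[of S] in auto)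
      also have "11/20 + 1/4 * (ln (cosh S) + max 0 (20/9 - x) / 2) = potential x S + x / 8"
        by (simp add: potential_def field_simps)
      finally show ?thesis by (simp add: x_def S_def)
    qed
    have "(\<Sum>e\<in>E. F e \<omega>) \<le> (\<Sum>e\<in>E. ennreal (z / 2 * (potential (info \<theta> (w *\<^sub>R e) \<omega> t) (score \<theta> (w *\<^sub>R e) \<omega> t)
        + info \<theta> (w *\<^sub>R e) \<omega> t / 8)))"
      by (intro sum_mono F)
    also have "\<dots> = ennreal (z / 2 * (\<Sum>e\<in>E. potential (info \<theta> (w *\<^sub>R e) \<omega> t) (score \<theta> (w *\<^sub>R e) \<omega> t)
        + info \<theta> (w *\<^sub>R e) \<omega> t / 8))"
      using cz potential_info_nonneg[of \<theta> _ \<omega> t] by (subst sum_ennreal) (auto simp: sum_distrib_left)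
    also have "\<dots> \<le> ennreal (\<kappa> * reg \<theta> (act \<theta> \<omega> t)
      + (\<Sum>e\<in>E. (reg (\<theta> + w *\<^sub>R e) (act \<theta> \<omega> t) + k) / 2 * lr \<theta> (w *\<^sub>R e) \<omega> t
          + (reg (\<theta> + - (w *\<^sub>R e)) (act \<theta> \<omega> t) + k) / 2 * lr \<theta> (- (w *\<^sub>R e)) \<omega> t)
      + z / 2 * (z / 4) * (\<Sum>s<t. reg \<theta> (act \<theta> \<omega> s)))"
      using pointwise_bound[OF \<omega> \<kappa>] unfolding \<theta>_def k_def by (rule ennreal_leI)
    also have "\<dots> = ennreal \<kappa> * ennreal (reg \<theta> (act \<theta> \<omega> t))
      + (\<Sum>e\<in>E. H (w *\<^sub>R e) \<omega> + H (- (w *\<^sub>R e)) \<omega>)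
      + ennreal (z / 2 * (z / 4)) * (\<Sum>s<t. ennreal (reg \<theta> (act \<theta> \<omega> s)))"
    proof -
      have nn: "0 \<le> (reg (\<theta> + v) (act \<theta> \<omega> t) + k) / 2 * lr \<theta> v \<omega> t" for v
        using pos k lr0[of v] by (intro mult_nonneg_nonneg) auto
      have "(\<Sum>e\<in>E. H (w *\<^sub>R e) \<omega> + H (- (w *\<^sub>R e)) \<omega>)
          = ennreal (\<Sum>e\<in>E. (reg (\<theta> + w *\<^sub>R e) (act \<theta> \<omega> t) + k) / 2 * lr \<theta> (w *\<^sub>R e) \<omega> t
          + (reg (\<theta> + - (w *\<^sub>R e)) (act \<theta> \<omega> t) + k) / 2 * lr \<theta> (- (w *\<^sub>R e)) \<omega> t)" (is "_ = ennreal ?X")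
        unfolding H by (rule sum_ennreal_add) (rule nn)+
      moreover have "0 \<le> ?X" using nn by (intro sum_nonneg add_nonneg_nonneg)
      moreover have "(\<Sum>s<t. ennreal (reg \<theta> (act \<theta> \<omega> s))) = ennreal (\<Sum>s<t. reg \<theta> (act \<theta> \<omega> s))"
        using pos by (intro sum_ennreal) auto
      moreover have "0 \<le> (\<Sum>s<t. reg \<theta> (act \<theta> \<omega> s))" using pos by (intro sum_nonneg) auto
      moreover have "0 \<le> reg \<theta> (act \<theta> \<omega> t)" using pos by auto
      ultimately show ?thesis
        using cz \<kappa>(1) by (simp only: ennreal_plus[symmetric] ennreal_mult'[symmetric] mult_nonneg_nonneg
            add_nonneg_nonneg divide_nonneg_nonneg less_imp_le)
    qed
    finally show "(\<Sum>e\<in>E. F e \<omega>) \<le> ennreal \<kappa> * ennreal (reg \<theta> (act \<theta> \<omega> t))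
      + (\<Sum>e\<in>E. H (w *\<^sub>R e) \<omega> + H (- (w *\<^sub>R e)) \<omega>)
      + ennreal (z / 2 * (z / 4)) * (\<Sum>s<t. ennreal (reg \<theta> (act \<theta> \<omega> s)))" .
  qed
  also have "\<dots> = ennreal \<kappa> * ennreal (mean_reg \<theta> t)
      + (\<Sum>e\<in>E. (\<integral>\<^sup>+\<omega>. H (w *\<^sub>R e) \<omega> \<partial>M t) + (\<integral>\<^sup>+\<omega>. H (- (w *\<^sub>R e)) \<omega> \<partial>M t))
      + ennreal (z / 2 * (z / 4)) * (\<Sum>s<t. ennreal (mean_reg \<theta> s))"
  proof -
    have "(\<integral>\<^sup>+\<omega>. (\<Sum>s<t. ennreal (reg \<theta> (act \<theta> \<omega> s))) \<partial>M t) = (\<Sum>s<t. ennreal (mean_reg \<theta> s))"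
      by (subst nn_integral_sum) (auto intro!: sum.cong nn_integral_reg_act reg_meas measurable_compose[OF reg_meas])
    then show ?thesis
      using reg_meas
      by (simp add: nn_integral_add nn_integral_cmult nn_integral_sum nn_integral_reg_act)
  qed
  also have "\<dots> = ennreal (\<kappa> * mean_reg \<theta> t + (\<Sum>e\<in>E. (mean_reg (\<theta> + w *\<^sub>R e) t + k) / 2 + (mean_reg (\<theta> - w *\<^sub>R e) t + k) / 2)
      + z / 2 * (z / 4) * (\<Sum>s<t. mean_reg \<theta> s))"
  proof -
    have "(\<integral>\<^sup>+\<omega>. H v \<omega> \<partial>M t) = ennreal ((mean_reg (\<theta> + v) t + k) / 2)" for v
    proof -
      have "(\<integral>\<^sup>+\<omega>. H v \<omega> \<partial>M t) = ennreal (1/2) * ennreal (mean_reg (\<theta> + v) t) + ennreal (k / 2)"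
        unfolding H_def using reg_meas[of t]
        by (simp add: nn_integral_add nn_integral_cmult nn_integral_reg_lr nn_integral_lr)
      also have "\<dots> = ennreal (1/2 * mean_reg (\<theta> + v) t + k / 2)"
        by (rule ennreal_affine(1)) (use k mean_reg_nonneg[of "\<theta> + v" t] in auto)
      finally show ?thesis by (simp add: add_divide_distrib)
    qed
    then have "(\<Sum>e\<in>E. (\<integral>\<^sup>+\<omega>. H (w *\<^sub>R e) \<omega> \<partial>M t) + (\<integral>\<^sup>+\<omega>. H (- (w *\<^sub>R e)) \<omega> \<partial>M t))
        = ennreal (\<Sum>e\<in>E. (mean_reg (\<theta> + w *\<^sub>R e) t + k) / 2 + (mean_reg (\<theta> - w *\<^sub>R e) t + k) / 2)" (is "_ = ennreal ?X")
      using k mean_reg_nonneg by (simp flip: ennreal_plus)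
    moreover have "0 \<le> ?X" using k mean_reg_nonneg by (intro sum_nonneg add_nonneg_nonneg) auto
    moreover have "(\<Sum>s<t. ennreal (mean_reg \<theta> s)) = ennreal (\<Sum>s<t. mean_reg \<theta> s)"
      using mean_reg_nonneg by (intro sum_ennreal) auto
    moreover have "0 \<le> (\<Sum>s<t. mean_reg \<theta> s)" using mean_reg_nonneg by (intro sum_nonneg) auto
    ultimately show ?thesis
      using cz \<kappa>(1) mean_reg_nonneg[of \<theta> t]
      by (simp only: ennreal_plus[symmetric] ennreal_mult'[symmetric] mult_nonneg_nonneg
            add_nonneg_nonneg divide_nonneg_nonneg less_imp_le)
  qed
  finally have "ennreal (z / 2 * (card E * (43/60))) \<le> ennreal (\<kappa> * mean_reg \<theta> t
      + (\<Sum>e\<in>E. (mean_reg (\<theta> + w *\<^sub>R e) t + k) / 2 + (mean_reg (\<theta> - w *\<^sub>R e) t + k) / 2)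
      + z / 2 * (z / 4) * (\<Sum>s<t. mean_reg \<theta> s))"
    using cz by (simp add: ennreal_of_nat_eq_real_of_nat mult_ac flip: ennreal_mult')
  then have "z / 2 * (card E * (43/60)) \<le> \<kappa> * mean_reg \<theta> t
      + (\<Sum>e\<in>E. (mean_reg (\<theta> + w *\<^sub>R e) t + k) / 2 + (mean_reg (\<theta> - w *\<^sub>R e) t + k) / 2)
      + z / 2 * (z / 4) * (\<Sum>s<t. mean_reg \<theta> s)"
  proof (rule ennreal_le_iff[THEN iffD1, rotated])
    show "0 \<le> \<kappa> * mean_reg \<theta> t
      + (\<Sum>e\<in>E. (mean_reg (\<theta> + w *\<^sub>R e) t + k) / 2 + (mean_reg (\<theta> - w *\<^sub>R e) t + k) / 2)
      + z / 2 * (z / 4) * (\<Sum>s<t. mean_reg \<theta> s)"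
      using cz \<kappa>(1) k by (intro add_nonneg_nonneg mult_nonneg_nonneg sum_nonneg divide_nonneg_nonneg) (auto intro: mean_reg_nonneg)
  qed
  also have "(\<Sum>e\<in>E. (mean_reg (\<theta> + w *\<^sub>R e) t + k) / 2 + (mean_reg (\<theta> - w *\<^sub>R e) t + k) / 2)
      = (\<Sum>e\<in>E. (mean_reg (\<theta> + w *\<^sub>R e) t + mean_reg (\<theta> - w *\<^sub>R e) t) / 2) + card E * k"
    by (simp add: sum.distrib add_divide_distrib)
  finally show ?thesis by (simp add: k_def algebra_simps)
qed

text \<open>Round 0 uses \<open>first_round_bound\<close>. Every later round uses
  \<open>round_bound\<close>, with the partial sum of null regrets enlarged to
  \<open>\<rho>\<close>; the charges to the null instance add up to at most
  \<open>\<kappa> * \<rho>\<close>.\<close>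

lemma total_bound:
  assumes \<kappa>: "0 \<le> \<kappa>" "9/5 \<le> \<kappa> + (real (card E) - 1) / 5" and T: "1 \<le> T"
  defines "\<theta> \<equiv> c *\<^sub>R h"
  defines "\<rho> \<equiv> \<Sum>t<T. mean_reg \<theta> t"
  shows "z / 2 * (card E * (1 - z / (4 * c)) + (real T - 1) * (card E * (43/60 - 1/400 - z / (4 * c)) - z / 4 * \<rho>)) - \<kappa> * \<rho>
    \<le> (\<Sum>e\<in>E. ((\<Sum>t<T. mean_reg (\<theta> + w *\<^sub>R e) t) + (\<Sum>t<T. mean_reg (\<theta> - w *\<^sub>R e) t)) / 2)"
proof -
  define D where "D t = (\<Sum>e\<in>E. (mean_reg (\<theta> + w *\<^sub>R e) t + mean_reg (\<theta> - w *\<^sub>R e) t) / 2)" for t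
  define q where "q = z / 2 * (card E * (43/60 - 1/400 - z / (4 * c)) - z / 4 * \<rho>)"
  obtain n where n: "T = Suc n" using T by (cases T) auto
  have first: "z / 2 * (card E * (1 - z / (4 * c))) \<le> D 0"
  proof -
    have "(\<Sum>e\<in>E. z / 2 * (1 - z / (4 * c))) \<le> D 0"
      unfolding D_def \<theta>_def by (intro sum_mono first_round_bound)
    then show ?thesis by (simp add: mult_ac)
  qed
  have later: "q - \<kappa> * mean_reg \<theta> t \<le> D t" if "t < T" for t
  proof -
    have "(\<Sum>s<t. mean_reg \<theta> s) \<le> \<rho>"
      unfolding \<rho>_def using that by (intro sum_mono2) (auto intro: mean_reg_nonneg)
    then have "z / 2 * (z / 4) * (\<Sum>s<t. mean_reg \<theta> s) \<le> z / 2 * (z / 4) * \<rho>"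
      using cz by (intro mult_left_mono) auto
    moreover have "q = z / 2 * (card E * (43/60)) - z / 2 * (card E * (1/400 + z / (4 * c))) - z / 2 * (z / 4) * \<rho>"
      by (simp add: q_def algebra_simps)
    ultimately show ?thesis
      using round_bound[OF \<kappa>, of t] unfolding \<theta>_def[symmetric] D_def[symmetric] by linarith
  qed
  have "z / 2 * (card E * (1 - z / (4 * c))) + (\<Sum>t<n. q - \<kappa> * mean_reg \<theta> (Suc t)) \<le> D 0 + (\<Sum>t<n. D (Suc t))"
    using n by (intro add_mono first sum_mono later) auto
  also have "\<dots> = (\<Sum>t<T. D t)" unfolding n by (rule sum.lessThan_Suc_shift[symmetric])
  also have "\<dots> = (\<Sum>e\<in>E. ((\<Sum>t<T. mean_reg (\<theta> + w *\<^sub>R e) t) + (\<Sum>t<T. mean_reg (\<theta> - w *\<^sub>R e) t)) / 2)"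
    unfolding D_def by (subst sum.swap) (simp add: sum.distrib flip: sum_divide_distrib)
  finally have "z / 2 * (card E * (1 - z / (4 * c))) + (real n * q - \<kappa> * (\<Sum>t<n. mean_reg \<theta> (Suc t)))
      \<le> (\<Sum>e\<in>E. ((\<Sum>t<T. mean_reg (\<theta> + w *\<^sub>R e) t) + (\<Sum>t<T. mean_reg (\<theta> - w *\<^sub>R e) t)) / 2)"
    by (simp add: sum_subtractf sum_distrib_left)
  moreover have "\<kappa> * (\<Sum>t<n. mean_reg \<theta> (Suc t)) \<le> \<kappa> * \<rho>"
    unfolding \<rho>_def n sum.lessThan_Suc_shift using mean_reg_nonneg[of \<theta> 0] \<kappa> by (intro mult_left_mono) auto
  moreover have "real n * q = (real T - 1) * q" using n by simp
  moreover have "z / 2 * (card E * (1 - z / (4 * c)) + (real T - 1) * (card E * (43/60 - 1/400 - z / (4 * c)) - z / 4 * \<rho>))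
      = z / 2 * (card E * (1 - z / (4 * c))) + (real T - 1) * q"
    unfolding q_def by (simp only: distrib_left mult.left_commute)
  ultimately show ?thesis by linarith
qed

end

subsection \<open>Balancing the two regrets\<close>

text \<open>\<open>\<kappa>\<close> is the least nonnegative value that \<open>round_bound\<close>
  admits for \<open>card E = d\<close>. \<open>\<Lambda>\<close> is the ratio of the coefficient
  \<open>2541/10000 * d / r\<close> of \<open>T\<close> reached in \<open>tradeoff\<close> to the
  target \<open>(d - 1) / (4 * r)\<close>. The second claim is the discriminant condition for
  \<open>\<Lambda> / 4 \<le> \<eta> * \<rho> + d / \<rho> * (4452/10000)\<close> with
  \<open>\<eta> = \<Lambda> - 1 - \<kappa> / d\<close>, since
  \<open>2848/100 \<le> 64 * (4452/10000)\<close>.\<close>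

lemma tradeoff_margin:
  fixes d :: real
  assumes "2 \<le> d"
  defines "\<kappa> \<equiv> max 0 (2 - d / 5)" and "\<Lambda> \<equiv> 10164/10000 * d / (d - 1)"
  shows "1 + \<kappa> / d < \<Lambda>" and "\<Lambda>\<^sup>2 \<le> 2848/100 * d * (\<Lambda> - 1 - \<kappa> / d)"
proof -
  have d: "0 < d" "0 < d - 1" using assms by auto
  define \<eta> where "\<eta> = \<Lambda> - 1 - \<kappa> / d"
  have "0 < \<eta> \<and> \<Lambda>\<^sup>2 \<le> 2848/100 * d * \<eta>"
  proof (cases "d \<le> 10")
    case True
    define p where "p = 2164/10000 * d\<^sup>2 - 6/5 * d + 2"
    have \<kappa>: "\<kappa> = 2 - d / 5" using True by (simp add: \<kappa>_def)
    have "d * \<eta> = 10164/10000 * d\<^sup>2 / (d - 1) - d - \<kappa>"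
      using d by (simp add: \<eta>_def \<Lambda>_def power2_eq_square right_diff_distrib)
    then have \<eta>: "d * \<eta> = p / (d - 1)"
      unfolding \<kappa> using d by (simp add: p_def field_simps power2_eq_square)
    \<comment> \<open>The vertex of the quadratic \<open>p - 363/10000 * (d + 2)\<close>. The factor
      363/10000 is large enough for
      \<open>(10164/10000)\<^sup>2 * (10000/363) \<le> 2848/100\<close>.\<close>
    have "0 \<le> (d - 12363/4328)\<^sup>2" by simp
    then have "363/10000 * (d + 2) \<le> p"
      by (simp add: p_def power2_eq_square field_simps)
    moreover have "d\<^sup>2 / (d - 1) \<le> d + 2"
      using assms(1) by (simp add: field_simps power2_eq_square)
    then have "363/10000 * (d\<^sup>2 / (d - 1)) \<le> 363/10000 * (d + 2)"
      by (intro mult_left_mono) auto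
    ultimately have p: "363/10000 * (d\<^sup>2 / (d - 1)) \<le> p" by (rule order_trans[rotated])
    then have "0 < p" using d by (smt (verit) divide_pos_pos mult_pos_pos zero_less_power)
    then have "0 < d * \<eta>" using d \<eta> by simp
    then have "0 < \<eta>" using d by (simp add: zero_less_mult_iff)
    moreover have "\<Lambda>\<^sup>2 \<le> 2848/100 * (d * \<eta>)"
    proof -
      have "(a * d / b)\<^sup>2 = a\<^sup>2 * (d\<^sup>2 / b) / b" for a b :: real
        by (simp add: power2_eq_square)
      then have "\<Lambda>\<^sup>2 = (10164/10000)\<^sup>2 * (d\<^sup>2 / (d - 1)) / (d - 1)"
        unfolding \<Lambda>_def .
      also have "\<dots> \<le> (10164/10000)\<^sup>2 * (10000/363 * p) / (d - 1)"
      proof (intro divide_right_mono mult_left_mono)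
        have "X \<le> 10000/363 * p" if "363/10000 * X \<le> p" for X using that by simp
        from this[OF p] show "d\<^sup>2 / (d - 1) \<le> 10000/363 * p" .
      qed (use d in auto)
      also have "\<dots> \<le> 2848/100 * (p / (d - 1))"
      proof -
        have "((10164/10000)\<^sup>2 * (10000/363)) * (p / (d - 1)) \<le> 2848/100 * (p / (d - 1))"
          using \<open>0 < p\<close> d by (intro mult_right_mono) (auto simp: power2_eq_square)
        then show ?thesis by simp
      qed
      finally show ?thesis by (simp add: \<eta>)
    qed
    ultimately show ?thesis by simp
  next
    case False
    then have \<kappa>: "\<kappa> = 0" by (simp add: \<kappa>_def)
    have \<eta>: "\<eta> = (164/10000 * d + 1) / (d - 1)"
      using d by (simp add: \<eta>_def \<kappa> \<Lambda>_def field_simps)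
    have "1 \<le> d * \<eta>" using False d unfolding \<eta> by (simp add: field_simps)
    moreover have "\<Lambda> \<le> 2" "0 \<le> \<Lambda>" using False d by (auto simp: \<Lambda>_def field_simps)
    then have "\<Lambda>\<^sup>2 \<le> 2\<^sup>2" by (intro power_mono)
    moreover have "0 < \<eta>" unfolding \<eta> using d by simp
    ultimately show ?thesis by simp
  qed
  then show "1 + \<kappa> / d < \<Lambda>" "\<Lambda>\<^sup>2 \<le> 2848/100 * d * (\<Lambda> - 1 - \<kappa> / d)"
    by (auto simp: \<eta>_def)
qed

text \<open>Assumption \<open>A\<close> is the conclusion of \<open>total_bound\<close> for
  \<open>4 * c = 3600\<close>. If \<open>\<rho>\<close> reaches the claimed bound, nothing remains;
  otherwise \<open>\<rho>\<close> is small enough to limit the charge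
  \<open>\<kappa> / d * \<rho>\<close>. The factor 7/5 in \<open>z\<close> nearly maximizes
  \<open>s * (713/1000 - s / 4)\<close>.\<close>

lemma tradeoff:
  fixes d T \<rho> A :: real
  assumes "2 \<le> d" "1 \<le> T" "0 \<le> \<rho>"
  defines "\<kappa> \<equiv> max 0 (2 - d / 5)" and "r \<equiv> max \<rho> (d - 1)"
  defines "z \<equiv> 7/5 * d / r"
  assumes A: "z / 2 * (d * (1 - z / 3600) + (T - 1) * (d * (43/60 - 1/400 - z / 3600) - z / 4 * \<rho>)) - \<kappa> * \<rho> \<le> d * A"
  shows "1/4 + T / 4 * (if \<rho> \<le> d - 1 then 1 else (d - 1) / \<rho>) \<le> max \<rho> A"
proof -
  define \<Lambda> where "\<Lambda> = 10164/10000 * d / (d - 1)"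
  note margin = tradeoff_margin[OF assms(1), folded \<kappa>_def \<Lambda>_def]
  have d: "0 < d" "0 < d - 1" and r: "0 < r" "d - 1 \<le> r" "\<rho> \<le> r" using assms(1) by (auto simp: r_def)
  have z: "0 < z" using d r by (simp add: z_def)
  have "z \<le> 28/10"
  proof -
    have "7/5 * d \<le> 28/10 * (d - 1)" using assms(1) by simp
    also have "\<dots> \<le> 28/10 * r" using r by simp
    finally show ?thesis using r by (simp add: z_def field_simps)
  qed
  then have small: "999/1000 \<le> 1 - z / 3600" "713/1000 \<le> 43/60 - 1/400 - z / 3600" by auto
  have zr: "z / 4 * \<rho> \<le> d * (35/100)"
  proof -
    have "z / 4 * \<rho> \<le> z / 4 * r" using z r by (intro mult_left_mono) auto
    also have "\<dots> = d * (35/100)" using r by (simp add: z_def)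
    finally show ?thesis .
  qed
  \<comment> \<open>A later round keeps \<open>713/1000 - 35/100 = 363/1000\<close>; the first keeps
    \<open>999/1000\<close>, which is \<open>636/1000\<close> more. Multiplication by 7/10 yields
    the coefficients 2541/10000 and 4452/10000 below.\<close>
  have "z / 2 * (d * (363/1000 * T + 636/1000)) - \<kappa> * \<rho>
      \<le> z / 2 * (d * (1 - z / 3600) + (T - 1) * (d * (43/60 - 1/400 - z / 3600) - z / 4 * \<rho>)) - \<kappa> * \<rho>"
  proof (intro diff_right_mono mult_left_mono)
    have "d * (363/1000 * T + 636/1000) = d * (999/1000) + (T - 1) * (d * (713/1000) - d * (35/100))"
      by (simp add: field_simps)
    also have "\<dots> \<le> d * (1 - z / 3600) + (T - 1) * (d * (43/60 - 1/400 - z / 3600) - z / 4 * \<rho>)"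
      using small d assms(2) zr by (intro add_mono mult_left_mono diff_mono) auto
    finally show "d * (363/1000 * T + 636/1000) \<le> d * (1 - z / 3600) + (T - 1) * (d * (43/60 - 1/400 - z / 3600) - z / 4 * \<rho>)" .
  qed (use z in simp)
  with A have "z / 2 * (d * (363/1000 * T + 636/1000)) - \<kappa> * \<rho> \<le> d * A" by linarith
  then have "(z / 2 * (d * (363/1000 * T + 636/1000)) - \<kappa> * \<rho>) / d \<le> A"
    using d by (simp add: pos_divide_le_eq mult.commute)
  moreover have "(z / 2 * (d * (363/1000 * T + 636/1000)) - \<kappa> * \<rho>) / d
      = d / r * (2541/10000 * T + 4452/10000) - \<kappa> / d * \<rho>"
    using d by (simp add: z_def diff_divide_distrib) (simp add: field_simps)
  ultimately have A': "d / r * (2541/10000 * T + 4452/10000) - \<kappa> / d * \<rho> \<le> A" by simp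
  show ?thesis
  proof (cases "\<rho> \<le> d - 1")
    case True
    then have r: "r = d - 1" by (simp add: r_def)
    show ?thesis
    proof (cases "(T + 1) / 4 \<le> \<rho>")
      case False
      have "(T + 1) / 4 \<le> (T + 1) / 4 * (\<Lambda> - \<kappa> / d)"
        using margin(1) assms(2) mult_left_mono[of 1 "\<Lambda> - \<kappa> / d" "(T + 1) / 4"] by simp
      also have "\<dots> = d / (d - 1) * (2541/10000 * (T + 1)) - \<kappa> / d * ((T + 1) / 4)"
      proof -
        have "(T + 1) / 4 * (10164/10000 * u - v) = u * (2541/10000 * (T + 1)) - v * ((T + 1) / 4)" for u v
          by (simp add: field_simps)
        from this[of "d / (d - 1)" "\<kappa> / d"] show ?thesis by (simp add: \<Lambda>_def)
      qed
      also have "\<dots> \<le> d / (d - 1) * (2541/10000 * T + 4452/10000) - \<kappa> / d * \<rho>"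
        using d False by (intro diff_mono mult_left_mono) (auto simp: \<kappa>_def)
      finally show ?thesis using A' True by (simp add: r add_divide_distrib)
    qed (use True in \<open>simp add: add_divide_distrib\<close>)
  next
    case False
    then have r: "r = \<rho>" and \<rho>: "0 < \<rho>" using d by (auto simp: r_def)
    define g where "g = T / 4 * ((d - 1) / \<rho>)"
    define \<eta> where "\<eta> = \<Lambda> - 1 - \<kappa> / d"
    have \<eta>: "0 < \<eta>" "\<Lambda>\<^sup>2 \<le> 2848/100 * d * \<eta>" using margin by (auto simp: \<eta>_def)
    show ?thesis
    proof (cases "1/4 + g \<le> \<rho>")
      case True
      then show ?thesis using False by (simp add: g_def)
    next
      case F: False
      have "1 \<le> \<Lambda>" using margin(1) d by (smt (verit) \<kappa>_def divide_nonneg_pos max.cobounded1)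
      then have "(\<Lambda> - 1) * (\<rho> - 1/4) \<le> (\<Lambda> - 1) * g"
        using F by (intro mult_left_mono) auto
      moreover have "\<Lambda> * g = d / \<rho> * (2541/10000 * T)"
      proof -
        have eq: "10164/10000 * d / b * (T / 4 * (b / \<rho>)) = d / \<rho> * (2541/10000 * T)" if "b \<noteq> 0" for b
          using that by simp
        show ?thesis unfolding \<Lambda>_def g_def by (rule eq) (use d in simp)
      qed
      \<comment> \<open>The inequality of arithmetic and geometric means for the two terms on the
        right; the second margin says that it suffices.\<close>
      moreover have "\<Lambda> / 4 \<le> \<eta> * \<rho> + d / \<rho> * (4452/10000)"
      proof -
        have de: "0 < d * \<eta>" using d \<eta> by simp
        have "0 \<le> (8 * (\<eta> * \<rho>) - \<Lambda>)\<^sup>2" by simp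
        also have "\<dots> = 64 * (\<eta> * \<rho>)\<^sup>2 - 16 * (\<eta> * \<rho>) * \<Lambda> + \<Lambda>\<^sup>2"
          by (simp add: power2_diff power_mult_distrib)
        finally have "16 * (\<eta> * \<rho>) * \<Lambda> \<le> 64 * (\<eta> * \<rho>)\<^sup>2 + 64 * (4452/10000) * (d * \<eta>)"
          using \<eta>(2)[unfolded mult.assoc] de by linarith
        then have "16 * (\<eta> * \<rho>) * \<Lambda> / (64 * (\<eta> * \<rho>))
            \<le> (64 * (\<eta> * \<rho>)\<^sup>2 + 64 * (4452/10000) * (d * \<eta>)) / (64 * (\<eta> * \<rho>))"
          using \<eta>(1) \<rho> by (intro divide_right_mono) auto
        also have "\<dots> = \<eta> * \<rho> + d / \<rho> * (4452/10000)"
          using \<eta>(1) \<rho> by (simp add: add_divide_distrib power2_eq_square)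
        finally show ?thesis using \<eta>(1) \<rho> by simp
      qed
      moreover have "\<eta> * \<rho> = (\<Lambda> - 1) * \<rho> - \<kappa> / d * \<rho>"
        by (simp only: \<eta>_def left_diff_distrib)
      moreover have "(\<Lambda> - 1) * (\<rho> - 1/4) = (\<Lambda> - 1) * \<rho> - \<Lambda> / 4 + 1/4" "(\<Lambda> - 1) * g = \<Lambda> * g - g"
        "d / \<rho> * (2541/10000 * T + 4452/10000) = d / \<rho> * (2541/10000 * T) + d / \<rho> * (4452/10000)"
        by (simp_all only: left_diff_distrib right_diff_distrib distrib_left)
      ultimately have "1/4 + g \<le> d / \<rho> * (2541/10000 * T + 4452/10000) - \<kappa> / d * \<rho>"
        by linarith
      then show ?thesis using A' False by (simp add: r g_def)
    qed
  qed
qed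

lemma half_sum_le: "x \<le> a \<Longrightarrow> y \<le> a \<Longrightarrow> (x + y) / 2 \<le> (a::real)"
  by simp

lemma best_action_scaled:
  assumes "norm h = 1" "0 < c"
  shows "best_action (c *\<^sub>R h) = h"
  using assms by (simp add: best_action_def)

lemma expected_hint_regret_eq:
  "best_action \<theta> = h \<Longrightarrow> expected_hint_regret Q \<pi> \<nu> T h \<theta> = expected_regret Q \<pi> \<nu> T \<theta>"
  by (simp add: expected_hint_regret_def expected_regret_def)

text \<open>
  For \<open>R = 0\<close> the extended quotient \<open>(d - 1) / R\<close> is \<open>- \<infinity>\<close>, \<open>0\<close> or \<open>\<infinity>\<close>, according to the sign of \<open>d - 1\<close>.
\<close>

lemma lower_bound_const:
  fixes d T :: nat and R :: real
  assumes "d \<le> 1" "0 \<le> R"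
  shows "ereal (1 / 4) + ereal (real T / 4) * min 1 (ereal (real d - 1) / ereal R) \<le> ereal (1 / 4)"
proof -
  have "ereal (real d - 1) / ereal R \<le> 0"
  proof (cases "R = 0")
    case True
    then show ?thesis
      using assms(1) by (cases "d = 0") (auto simp: divide_ereal_def)
  next
    case False
    then show ?thesis using assms by (auto simp: field_simps)
  qed
  then have "min 1 (ereal (real d - 1) / ereal R) \<le> 0" by (simp add: min_le_iff_disj)
  then have "ereal (real T / 4) * min 1 (ereal (real d - 1) / ereal R) \<le> 0"
    by (simp add: ereal_mult_le_0_iff)
  then show ?thesis
    using add_left_mono[of _ 0 "ereal (1/4)"] by simp
qed

text \<open>For \<open>d \<ge> 2\<close> and \<open>R = 0\<close> the extended quotient is infinite
  and the minimum is 1, in agreement with the case split, which never divides by zero.\<close>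

lemma lower_bound_real:
  fixes d T :: nat and R :: real
  assumes "2 \<le> d" "0 \<le> R"
  shows "ereal (1 / 4) + ereal (real T / 4) * min 1 (ereal (real d - 1) / ereal R)
    = ereal (1/4 + real T / 4 * (if R \<le> real d - 1 then 1 else (real d - 1) / R))"
proof (cases "R = 0")
  case True
  then show ?thesis using assms by (simp add: divide_ereal_def one_ereal_def min_def)
next
  case False
  then have "0 < R" using assms by simp
  then have "min 1 (ereal (real d - 1) / ereal R) = ereal (if R \<le> real d - 1 then 1 else (real d - 1) / R)"
    by (auto simp: min_def one_ereal_def field_simps)
  then show ?thesis by simp
qed

text \<open>As \<open>R\<close> tends to 0, \<open>d * T / R\<close> is unbounded while the bound
  never exceeds \<open>1/4 + T / 4\<close>. The comparison is therefore made under
  \<open>\<kappa> * d \<le> R\<close>, with a constant proportional to \<open>\<kappa>\<close>; it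
  uses \<open>d - 1 \<ge> d / 2\<close>.\<close>

lemma lower_bound_ge:
  fixes d T :: nat and R \<kappa> :: real
  assumes "2 \<le> d" "0 \<le> R" "0 < \<kappa>" "\<kappa> \<le> 1" "\<kappa> * real d \<le> R"
  shows "\<kappa> / 8 * (real d * real T / R)
    \<le> 1/4 + real T / 4 * (if R \<le> real d - 1 then 1 else (real d - 1) / R)"
proof -
  have d: "0 < real d" using assms(1) by simp
  then have R: "0 < R" using assms by (smt (verit) mult_pos_pos)
  have "\<kappa> / 2 * (real d / R) \<le> (if R \<le> real d - 1 then 1 else (real d - 1) / R)"
  proof (cases "R \<le> real d - 1")
    case True
    then show ?thesis using R assms(5) by (simp add: field_simps)
  next
    case False
    have "\<kappa> / 2 * real d \<le> 1 / 2 * real d" using assms(4) d by (intro mult_right_mono) auto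
    also have "\<dots> \<le> real d - 1" using assms(1) by simp
    finally have "\<kappa> / 2 * real d / R \<le> (real d - 1) / R"
      using R by (intro divide_right_mono) auto
    then show ?thesis using False by simp
  qed
  then have "real T / 4 * (\<kappa> / 2 * (real d / R)) \<le> real T / 4 * (if R \<le> real d - 1 then 1 else (real d - 1) / R)"
    by (intro mult_left_mono) auto
  then show ?thesis by (simp add: mult_ac)
qed

lemma lower_bound_antimono:
  fixes d T R \<rho> :: real
  assumes "1 < d" "0 \<le> T" "\<rho> \<le> R" "0 \<le> \<rho>"
  shows "1/4 + T / 4 * (if R \<le> d - 1 then 1 else (d - 1) / R)
    \<le> 1/4 + T / 4 * (if \<rho> \<le> d - 1 then 1 else (d - 1) / \<rho>)"
  using assms by (intro add_left_mono mult_left_mono) (auto intro!: divide_left_mono)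

lemma orthonormal_complement:
  fixes h :: "'a::euclidean_space"
  assumes "norm h = 1"
  obtains E where "finite E" "h \<notin> E" "pairwise orthogonal (insert h E)" "\<And>e. e \<in> E \<Longrightarrow> norm e = 1"
    "card E = DIM('a) - 1"
proof -
  obtain S where S: "h \<in> S" "pairwise orthogonal S" "\<And>x. x \<in> S \<Longrightarrow> norm x = 1"
    "independent S" "card S = DIM('a)" "span S = UNIV"
    using vector_in_orthonormal_basis[OF assms] by metis
  then have "finite S" using independent_imp_finite by blast
  then show ?thesis
    using S by (intro that[of "S - {h}"]) (auto simp: insert_absorb)
qed

theorem theorem1:
  fixes h :: "'a::euclidean_space"
    and Q :: "'u measure"
    and \<pi> :: "nat \<Rightarrow> 'u \<times> (nat \<Rightarrow> real) \<Rightarrow> 'a"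
    and d T :: nat
  assumes "DIM('a) = d + 1"
    and "h \<in> cball 0 1" and "norm h = 1"
    and "T \<ge> 1"
    and "learning_algorithm Q \<pi>"
  shows "\<exists>\<Theta> \<nu>. finite \<Theta> \<and> \<Theta> \<noteq> {} \<and> centered_subgaussian \<nu> \<and>
    (\<forall>\<theta>\<in>\<Theta>. 1 / 1000 \<le> norm \<theta> \<and> norm \<theta> \<le> 1000) \<and>
    (let R = max_hint_regret Q \<pi> \<nu> T h \<Theta>;
         L = ereal (1 / 4) + ereal (real T / 4) * min 1 (ereal (real d - 1) / ereal R) in
      0 \<le> R \<and>
      (\<exists>\<theta>\<in>\<Theta>. ereal (expected_regret Q \<pi> \<nu> T \<theta>) \<ge> L) \<and>
      (\<forall>\<kappa>. d \<ge> 2 \<and> 0 < \<kappa> \<and> \<kappa> \<le> 1 \<and> \<kappa> * real d \<le> R \<longrightarrow>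
        L \<ge> ereal (\<kappa> / 8 * (real d * real T / R))))"
proof -
  interpret learner Q \<pi> by unfold_locales (rule assms(5))
  have h: "norm h = 1" by (rule assms(3))
  \<comment> \<open>The hint is the best action in \<open>c h\<close>, so its hint-based regret is
    its regret there.\<close>
  have R_ge: "expected_regret Q \<pi> gauss T (c *\<^sub>R h) \<le> max_hint_regret Q \<pi> gauss T h \<Theta>"
    if "finite \<Theta>" "c *\<^sub>R h \<in> \<Theta>" "0 < c" for \<Theta> c
    unfolding max_hint_regret_def
    using that expected_hint_regret_eq[OF best_action_scaled[OF h that(3)], of Q \<pi> gauss T]
    by (metis Max_ge finite_imageI imageI)
  have regret_nonneg: "0 \<le> expected_regret Q \<pi> gauss T \<theta>" for \<theta>
    unfolding expected_regret_eq by (intro sum_nonneg mean_reg_nonneg)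
  show ?thesis
  proof (cases "d \<ge> 2")
    case False
    \<comment> \<open>For \<open>d \<le> 1\<close> the claimed bound is at most 1/4, and two
      opposite instances suffice: the first action is chosen before any observation, so their mean
      regrets in round 0 add up to 2.\<close>
    define \<Theta> where "\<Theta> = {1 *\<^sub>R h, - h}"
    define R where "R = max_hint_regret Q \<pi> gauss T h \<Theta>"
    have R: "0 \<le> R"
      using R_ge[of \<Theta> 1] regret_nonneg[of "1 *\<^sub>R h"] by (simp add: R_def \<Theta>_def)
    have "\<exists>\<theta>\<in>\<Theta>. 1/4 \<le> expected_regret Q \<pi> gauss T \<theta>"
    proof -
      interpret prob_space "M 0" by (rule prob_space_M)
      have a: "act \<theta> \<omega> 0 = \<pi> 0 (fst \<omega>, \<lambda>_. undefined)" for \<theta> \<omega> by (simp add: action_def)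
      have int: "integrable (M 0) (\<lambda>\<omega>. reg \<theta> (\<pi> 0 (fst \<omega>, \<lambda>_. undefined)))" for \<theta>
        using integrable_reg_act[of 0 0 \<theta>] by (simp only: a)
      have "mean_reg h 0 + mean_reg (- h) 0
          = (\<integral>\<omega>. reg h (\<pi> 0 (fst \<omega>, \<lambda>_. undefined)) + reg (- h) (\<pi> 0 (fst \<omega>, \<lambda>_. undefined)) \<partial>M 0)"
        unfolding mean_reg_def a using int by simp
      also have "\<dots> = 2" using prob_space h by (simp add: reg_def)
      finally have "1 \<le> mean_reg h 0 \<or> 1 \<le> mean_reg (- h) 0" by linarith
      moreover have le: "mean_reg \<theta> 0 \<le> expected_regret Q \<pi> gauss T \<theta>" for \<theta>
        unfolding expected_regret_eq using assms(4) by (intro member_le_sum) (auto intro: mean_reg_nonneg)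
      ultimately have "1/4 \<le> expected_regret Q \<pi> gauss T h \<or> 1/4 \<le> expected_regret Q \<pi> gauss T (- h)"
        using le[of h] le[of "- h"] by linarith
      then show ?thesis by (auto simp: \<Theta>_def)
    qed
    moreover have "ereal (1 / 4) + ereal (real T / 4) * min 1 (ereal (real d - 1) / ereal R) \<le> ereal (1 / 4)"
      using False R by (intro lower_bound_const) auto
    ultimately have "\<exists>\<theta>\<in>\<Theta>. ereal (1 / 4) + ereal (real T / 4) * min 1 (ereal (real d - 1) / ereal R)
        \<le> ereal (expected_regret Q \<pi> gauss T \<theta>)"
      by (meson ereal_less_eq(3) order_trans)
    moreover have "\<forall>\<theta>\<in>\<Theta>. 1 / 1000 \<le> norm \<theta> \<and> norm \<theta> \<le> 1000" using h by (auto simp: \<Theta>_def)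
    ultimately show ?thesis
      using False R centered_subgaussian_gauss unfolding Let_def R_def
      by (intro exI[of _ \<Theta>] exI[of _ gauss] conjI) (simp_all add: \<Theta>_def)
  next
    case True
    obtain E where E: "finite E" "h \<notin> E" "pairwise orthogonal (insert h E)" "\<And>e. e \<in> E \<Longrightarrow> norm e = 1"
      and card_E: "card E = d"
      using orthonormal_complement[OF h] assms(1) by (metis add_diff_cancel_right')
    \<comment> \<open>Large enough to make \<open>z / (4 * c)\<close> negligible, and small enough
      to keep \<open>sqrt (c\<^sup>2 + c * z)\<close> below 1000 for
      \<open>z \<le> 28/10\<close>.\<close>
    define c :: real where "c = 900"
    define \<rho> where "\<rho> = expected_regret Q \<pi> gauss T (c *\<^sub>R h)"
    define \<kappa> :: real where "\<kappa> = max 0 (2 - real d / 5)"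
    \<comment> \<open>The null instance does not involve \<open>z\<close>, so the family may be
      adapted to the regret \<open>\<rho>\<close> of the algorithm there.\<close>
    define z where "z = 7/5 * real d / max \<rho> (real d - 1)"
    have z: "0 < z" "z \<le> 28/10"
    proof -
      have m: "0 < max \<rho> (real d - 1)" using True by auto
      show "0 < z" using m True by (simp add: z_def)
      have "7/5 * real d \<le> 28/10 * (real d - 1)" using True by simp
      also have "\<dots> \<le> 28/10 * max \<rho> (real d - 1)" by (intro mult_left_mono) auto
      finally show "z \<le> 28/10" using m by (simp add: z_def pos_divide_le_eq)
    qed
    interpret hinted_learner Q \<pi> h E c z
      by unfold_locales (use h E z in \<open>auto simp: c_def\<close>)
    define \<Theta> where "\<Theta> = insert (c *\<^sub>R h) ((\<lambda>e. c *\<^sub>R h + w *\<^sub>R e) ` E \<union> (\<lambda>e. c *\<^sub>R h - w *\<^sub>R e) ` E)"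
    define A where "A = Max (expected_regret Q \<pi> gauss T ` \<Theta>)"
    have fin: "finite \<Theta>" using E by (simp add: \<Theta>_def)
    have A: "expected_regret Q \<pi> gauss T \<theta> \<le> A" if "\<theta> \<in> \<Theta>" for \<theta>
      unfolding A_def using fin that by simp
    have "A \<in> expected_regret Q \<pi> gauss T ` \<Theta>"
      unfolding A_def using fin by (intro Max_in) (auto simp: \<Theta>_def)
    then obtain \<theta> where \<theta>: "\<theta> \<in> \<Theta>" "expected_regret Q \<pi> gauss T \<theta> = A"
      by blast
    define R where "R = max_hint_regret Q \<pi> gauss T h \<Theta>"
    have R: "\<rho> \<le> R" "0 \<le> R" "0 \<le> \<rho>"
      using R_ge[OF fin, of c] regret_nonneg[of "c *\<^sub>R h"] by (auto simp: R_def \<rho>_def \<Theta>_def c_def)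
    have "(\<Sum>e\<in>E. ((\<Sum>t<T. mean_reg (c *\<^sub>R h + w *\<^sub>R e) t) + (\<Sum>t<T. mean_reg (c *\<^sub>R h - w *\<^sub>R e) t)) / 2) \<le> (\<Sum>e\<in>E. A)"
    proof (rule sum_mono)
      fix e assume "e \<in> E"
      then have "c *\<^sub>R h + w *\<^sub>R e \<in> \<Theta>" "c *\<^sub>R h - w *\<^sub>R e \<in> \<Theta>" by (auto simp: \<Theta>_def)
      from this[THEN A] show "((\<Sum>t<T. mean_reg (c *\<^sub>R h + w *\<^sub>R e) t) + (\<Sum>t<T. mean_reg (c *\<^sub>R h - w *\<^sub>R e) t)) / 2 \<le> A"
        unfolding expected_regret_eq by (rule half_sum_le)
    qed
    moreover have "0 \<le> \<kappa>" "9/5 \<le> \<kappa> + (real (card E) - 1) / 5"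
      using card_E by (auto simp: \<kappa>_def max_def field_simps)
    ultimately have "z / 2 * (real d * (1 - z / 3600) + (real T - 1) * (real d * (43/60 - 1/400 - z / 3600) - z / 4 * \<rho>)) - \<kappa> * \<rho>
        \<le> real d * A"
      using total_bound[of \<kappa> T] assms(4) card_E by (simp add: \<rho>_def expected_regret_eq c_def)
    then have "1/4 + real T / 4 * (if \<rho> \<le> real d - 1 then 1 else (real d - 1) / \<rho>) \<le> max \<rho> A"
      unfolding z_def \<kappa>_def by (intro tradeoff) (use True assms(4) R in auto)
    \<comment> \<open>The null instance belongs to the family, so the alternative that
      \<open>\<rho>\<close> is large is covered by \<open>A\<close>.\<close>
    also have "max \<rho> A = A" using A[of "c *\<^sub>R h"] by (simp add: \<rho>_def \<Theta>_def)
    finally have "1/4 + real T / 4 * (if R \<le> real d - 1 then 1 else (real d - 1) / R) \<le> A"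
      using lower_bound_antimono[of "real d" "real T" \<rho> R] True R by linarith
    then have "\<exists>\<theta>\<in>\<Theta>. ereal (1 / 4) + ereal (real T / 4) * min 1 (ereal (real d - 1) / ereal R)
        \<le> ereal (expected_regret Q \<pi> gauss T \<theta>)"
      unfolding lower_bound_real[OF True R(2)] using \<theta> by auto
    moreover have "\<forall>\<theta>\<in>\<Theta>. 1 / 1000 \<le> norm \<theta> \<and> norm \<theta> \<le> 1000"
    proof -
      have "norm \<theta> = 900 \<or> norm \<theta> = sqrt (c\<^sup>2 + c * z)" if "\<theta> \<in> \<Theta>" for \<theta>
      proof -
        have "norm (c *\<^sub>R h) = 900" using h by (simp add: c_def)
        moreover have "norm (c *\<^sub>R h + w *\<^sub>R e) = sqrt (c\<^sup>2 + c * z)" "norm (c *\<^sub>R h - w *\<^sub>R e) = sqrt (c\<^sup>2 + c * z)"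
          if "e \<in> E" for e
          using norm_instance[OF that, of w] norm_instance[OF that, of "- w"] w(1) by simp_all
        ultimately show ?thesis using that unfolding \<Theta>_def by blast
      qed
      moreover have "c \<le> sqrt (c\<^sup>2 + c * z)"
        using z by (intro real_le_rsqrt) (simp add: c_def)
      moreover have "sqrt (c\<^sup>2 + c * z) \<le> sqrt (1000\<^sup>2)"
        using z by (intro real_sqrt_le_mono) (simp add: c_def power2_eq_square)
      ultimately show ?thesis unfolding c_def by fastforce
    qed
    moreover have "\<forall>\<kappa>. 0 < \<kappa> \<and> \<kappa> \<le> 1 \<and> \<kappa> * real d \<le> R \<longrightarrow> ereal (\<kappa> / 8 * (real d * real T / R))
        \<le> ereal (1 / 4) + ereal (real T / 4) * min 1 (ereal (real d - 1) / ereal R)"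
      unfolding lower_bound_real[OF True R(2)] using lower_bound_ge[OF True R(2)] by auto
    moreover have "\<Theta> \<noteq> {}" by (simp add: \<Theta>_def)
    ultimately show ?thesis
      using R(2) fin centered_subgaussian_gauss unfolding Let_def R_def by blast
  qed
qed

end
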